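(* Let $n\ge2$, let $\varphi=|x|^2$ and let $\Omega\subset\mathbb{R}^n\setminus\{0\}$ be a domain. For every $f\in L^2_\varphi(\Omega,\mathbb{R}_n)$ there exists $u\in L^2_\varphi(\Omega,\mathbb{R}_n)$ such that $$\Delta u=f\quad\text{in }\Omega$$ and $$\|u\|_\varphi^2\le\frac1{16}\|f\|_\varphi^2 .$$ If $f$ is real-valued, then $u$ can be chosen real-valued with the same estimate.
   Context: $\mathbb{R}_n$ is the real Clifford algebra: the associative unital $\mathbb{R}$-algebra generated by $e_1,\dots,e_n$ with $e_j^2=-1$ and $e_je_k+e_ke_j=0$ for $j\ne k$. It has real dimension $2^n$, with basis $e_A=e_{j_1}\cdots e_{j_\ell}$ for $A=\{j_1<\dots<j_\ell\}\subset\{1,\dots,n\}$, $e_\emptyset=1$; for $f=\sum_A f_Ae_A$ put $|f|^2=\sum_A f_A^2$. Real-valued means taking values in $\mathbb{R}\cdot e_\emptyset$. $L^2_\varphi(\Omega,\mathbb{R}_n)$ is the space of measurable $u:\Omega\to\mathbb{R}_n$ with $\|u\|_\varphi^2=\int_\Omega|u|^2e^{-\varphi}\,dV<\infty$. $\Delta=\sum_j\partial_j^2$ acts componentwise and the equation $\Delta u=f$ is understood in the sense of distributions. A domain is a nonempty connected open set. *)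

theory Defs
  imports "HOL-Analysis.Analysis"
begin

section \<open>The real Clifford algebra\<close>

text \<open>
  The generators are indexed by a finite linearly ordered type; an element is the family of its
  coefficients with respect to the basis of blades \<open>e\<^sub>A\<close>, the products of the generators in \<open>A\<close>
  taken in increasing order.
\<close>

typedef 'n clifford = "UNIV :: ('n set \<Rightarrow> real) set"
  morphisms coeff Clifford ..

lemma coeff_Clifford [simp]: "coeff (Clifford f) A = f A"
  by (simp add: Clifford_inverse)

lemma clifford_eq_iff: "x = y \<longleftrightarrow> (\<forall>A. coeff x A = coeff y A)"
  by (metis coeff_inject ext)

text \<open>
  \<open>e\<^sub>A e\<^sub>B = blade_sign A B *\<^sub>R e\<^sub>C\<close> with \<open>C\<close> the symmetric difference: each pair \<open>b < a\<close> contributes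
  a sign from anticommuting, each common index a sign from \<open>e\<^sub>j\<^sup>2 = -1\<close>.
\<close>

definition blade_sign :: "'n::{finite,linorder} set \<Rightarrow> 'n set \<Rightarrow> real" where
  "blade_sign A B = (\<Prod>a\<in>A. \<Prod>b\<in>B. if b \<le> a then - 1 else 1)"

lemma prod_sym_diff_sign:
  fixes f :: "'a::finite \<Rightarrow> real"
  assumes "\<And>a. f a * f a = 1"
  shows "prod f (sym_diff A B) = prod f A * prod f B"
proof -
  have A: "prod f A = prod f (A - B) * prod f (A \<inter> B)"
    using prod.Int_Diff[of A f B] by (simp add: mult.commute)
  have B: "prod f B = prod f (B - A) * prod f (A \<inter> B)"
    using prod.Int_Diff[of B f A] by (simp add: mult.commute Int_commute)
  have "prod f (A \<inter> B) * prod f (A \<inter> B) = 1"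
    by (simp add: prod.distrib[symmetric] assms)
  then have "prod f A * prod f B = prod f (A - B) * prod f (B - A)"
    unfolding A B by (simp add: algebra_simps)
  also have "\<dots> = prod f (sym_diff A B)"
    by (rule prod.union_disjoint[symmetric]) auto
  finally show ?thesis by simp
qed

lemma blade_sign_inner_sq:
  "(\<Prod>b\<in>B. if b \<le> a then - 1 else (1::real)) * (\<Prod>b\<in>B. if b \<le> a then - 1 else 1) = 1"
  unfolding prod.distrib[symmetric] by (rule prod.neutral) auto

lemma blade_sign_sym_diff_left:
  "blade_sign (sym_diff A B) C = blade_sign A C * blade_sign B C"
  unfolding blade_sign_def by (rule prod_sym_diff_sign) (rule blade_sign_inner_sq)

lemma blade_sign_sym_diff_right:
  "blade_sign A (sym_diff B C) = blade_sign A B * blade_sign A C"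
  unfolding blade_sign_def
  by (subst prod_sym_diff_sign) (auto simp: prod.distrib)

lemma blade_sign_square: "blade_sign A B * blade_sign A B = 1"
  unfolding blade_sign_def prod.distrib[symmetric]
  by (intro prod.neutral ballI) auto

instantiation clifford :: (type) real_vector
begin

definition "0 = Clifford (\<lambda>A. 0)"
definition "x + y = Clifford (\<lambda>A. coeff x A + coeff y A)"
definition "- x = Clifford (\<lambda>A. - coeff x A)"
definition "x - y = Clifford (\<lambda>A. coeff x A - coeff y A)"
definition "r *\<^sub>R x = Clifford (\<lambda>A. r * coeff x A)"

instance
  by standard
    (auto simp: clifford_eq_iff zero_clifford_def plus_clifford_def uminus_clifford_def
      minus_clifford_def scaleR_clifford_def algebra_simps)

end

lemma coeff_simps [simp]:
  "coeff 0 A = 0"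
  "coeff (x + y) A = coeff x A + coeff y A"
  "coeff (- x) A = - coeff x A"
  "coeff (x - y) A = coeff x A - coeff y A"
  "coeff (r *\<^sub>R x) A = r * coeff x A"
  by (simp_all add: zero_clifford_def plus_clifford_def uminus_clifford_def
      minus_clifford_def scaleR_clifford_def)

definition blade :: "'n set \<Rightarrow> 'n clifford" where
  "blade A = Clifford (\<lambda>B. if B = A then 1 else 0)"

lemma coeff_blade [simp]: "coeff (blade A) B = (if B = A then 1 else 0)"
  by (simp add: blade_def)

text \<open>In the product, \<open>B\<close> is the only index set with \<open>sym_diff A B = C\<close>.\<close>

instantiation clifford :: ("{finite,linorder}") real_algebra_1
begin

definition "1 = blade {}"
definition "x * y =
  Clifford (\<lambda>C. \<Sum>A\<in>UNIV. let B = sym_diff A C in blade_sign A B * coeff x A * coeff y B)"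

instance
proof
  fix a b c :: "'a clifford" and r :: real
  have rearrange: "p * u * (q * v * w) = s * (t * u * v) * w" if "p * q = s * t"
    for p q s t u v w :: real
  proof -
    have "p * u * (q * v * w) = (p * q) * (u * v * w)" by (simp only: ac_simps)
    also have "\<dots> = s * (t * u * v) * w" unfolding that by (simp only: ac_simps)
    finally show ?thesis .
  qed
  have inv: "sym_diff A (sym_diff A C) = C" for A C :: "'a set" by auto
  have sw: "sym_diff (sym_diff A D) (sym_diff A C) = sym_diff D C" for A C D :: "'a set" by auto
  show "a * b * c = a * (b * c)"
  proof (unfold clifford_eq_iff, intro allI)
    fix C
    have "coeff (a * b * c) C = (\<Sum>D\<in>UNIV. \<Sum>A\<in>UNIV.
        blade_sign D (sym_diff D C) * (blade_sign A (sym_diff A D) * coeff a A *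
          coeff b (sym_diff A D)) * coeff c (sym_diff D C))"
      by (simp add: times_clifford_def Let_def sum_distrib_left sum_distrib_right)
    also have "\<dots> = (\<Sum>A\<in>UNIV. \<Sum>D\<in>UNIV.
        blade_sign D (sym_diff D C) * (blade_sign A (sym_diff A D) * coeff a A *
          coeff b (sym_diff A D)) * coeff c (sym_diff D C))"
      by (rule sum.swap)
    also have "\<dots> = (\<Sum>A\<in>UNIV. \<Sum>B\<in>UNIV. blade_sign A (sym_diff A C) * coeff a A *
        (blade_sign B (sym_diff B (sym_diff A C)) * coeff b B *
          coeff c (sym_diff B (sym_diff A C))))"
    proof (rule sum.cong[OF refl])
      fix A :: "'a set"
      have bij: "bij_betw (sym_diff A) UNIV UNIV"
        by (rule bij_betwI[where g = "sym_diff A"]) (use inv in auto)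
      have "(\<Sum>B\<in>UNIV. blade_sign A (sym_diff A C) * coeff a A *
          (blade_sign B (sym_diff B (sym_diff A C)) * coeff b B *
            coeff c (sym_diff B (sym_diff A C)))) =
        (\<Sum>D\<in>UNIV. blade_sign A (sym_diff A C) * coeff a A *
          (blade_sign (sym_diff A D) (sym_diff D C) * coeff b (sym_diff A D) *
            coeff c (sym_diff D C)))"
        using sum.reindex_bij_betw[OF bij, of "\<lambda>B. blade_sign A (sym_diff A C) * coeff a A *
          (blade_sign B (sym_diff B (sym_diff A C)) * coeff b B *
            coeff c (sym_diff B (sym_diff A C)))", symmetric] by (simp only: sw)
      also have "\<dots> = (\<Sum>D\<in>UNIV. blade_sign D (sym_diff D C) * (blade_sign A (sym_diff A D) *
          coeff a A * coeff b (sym_diff A D)) * coeff c (sym_diff D C))"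
      proof (rule sum.cong[OF refl])
        fix D
        have "sym_diff A C = sym_diff (sym_diff A D) (sym_diff D C)" by auto
        then have "blade_sign A (sym_diff A C)
            = blade_sign A (sym_diff A D) * blade_sign A (sym_diff D C)"
          by (simp only: blade_sign_sym_diff_right)
        moreover have "blade_sign A (sym_diff D C) * blade_sign A (sym_diff D C) = 1"
          by (rule blade_sign_square)
        ultimately have "blade_sign A (sym_diff A C) * blade_sign (sym_diff A D) (sym_diff D C)
            = blade_sign D (sym_diff D C) * blade_sign A (sym_diff A D)"
          by (simp only: blade_sign_sym_diff_left) (simp add: algebra_simps)
        then show "blade_sign A (sym_diff A C) * coeff a A *
          (blade_sign (sym_diff A D) (sym_diff D C) * coeff b (sym_diff A D) *
            coeff c (sym_diff D C)) = blade_sign D (sym_diff D C) * (blade_sign A (sym_diff A D) *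
          coeff a A * coeff b (sym_diff A D)) * coeff c (sym_diff D C)"
          by (rule rearrange)
      qed
      finally show "(\<Sum>D\<in>UNIV. blade_sign D (sym_diff D C) * (blade_sign A (sym_diff A D) *
          coeff a A * coeff b (sym_diff A D)) * coeff c (sym_diff D C)) =
        (\<Sum>B\<in>UNIV. blade_sign A (sym_diff A C) * coeff a A *
          (blade_sign B (sym_diff B (sym_diff A C)) * coeff b B *
            coeff c (sym_diff B (sym_diff A C))))" by simp
    qed
    also have "\<dots> = coeff (a * (b * c)) C"
      by (simp add: times_clifford_def Let_def sum_distrib_left)
    finally show "coeff (a * b * c) C = coeff (a * (b * c)) C" .
  qed
  show "(a + b) * c = a * c + b * c" "a * (b + c) = a * b + a * c"
    by (simp_all add: clifford_eq_iff times_clifford_def Let_def sum.distrib algebra_simps)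
  show "r *\<^sub>R a * b = r *\<^sub>R (a * b)" "a * r *\<^sub>R b = r *\<^sub>R (a * b)"
    by (simp_all add: clifford_eq_iff times_clifford_def Let_def sum_distrib_left algebra_simps)
  have "(\<Sum>A\<in>UNIV. blade_sign A (sym_diff A C) * coeff 1 A * coeff a (sym_diff A C)) =
      (\<Sum>A\<in>(UNIV :: 'a set set). if A = {} then coeff a C else 0)" for C
    by (rule sum.cong) (auto simp: one_clifford_def blade_sign_def)
  then show "1 * a = a"
    by (simp add: clifford_eq_iff times_clifford_def Let_def)
  have "blade_sign A (sym_diff A C) * coeff a A * coeff 1 (sym_diff A C) =
      (if A = C then coeff a C else 0)" for A C
  proof (cases "A = C")
    case True
    then show ?thesis by (simp add: one_clifford_def blade_sign_def)
  next
    case False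
    then have "sym_diff A C \<noteq> {}" by blast
    then show ?thesis using False by (simp only: one_clifford_def coeff_blade if_False mult_zero_right)
  qed
  then show "a * 1 = a"
    by (simp add: clifford_eq_iff times_clifford_def Let_def)
  have "coeff (0 :: 'a clifford) {} \<noteq> coeff 1 {}"
    by (simp add: one_clifford_def)
  then show "(0 :: 'a clifford) \<noteq> 1" by metis
qed

end

lemma blade_mult: "blade A * blade B = blade_sign A B *\<^sub>R blade (sym_diff A B)"
proof (unfold clifford_eq_iff, intro allI)
  fix C
  have term_eq: "blade_sign D (sym_diff D C) * coeff (blade A) D * coeff (blade B) (sym_diff D C) =
      (if D = A then blade_sign A B * coeff (blade (sym_diff A B)) C else 0)" for D
  proof (cases "D = A")
    case True
    have "C = sym_diff A B \<longleftrightarrow> sym_diff A C = B" by auto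
    then show ?thesis using True by (simp only: coeff_blade) simp
  qed simp
  show "coeff (blade A * blade B) C = coeff (blade_sign A B *\<^sub>R blade (sym_diff A B)) C"
    by (simp only: times_clifford_def Let_def coeff_Clifford term_eq) simp
qed

abbreviation clifford_gen :: "'n \<Rightarrow> 'n clifford" where
  "clifford_gen j \<equiv> blade {j}"

lemma clifford_gen_square: "clifford_gen j * clifford_gen j = - 1"
  by (simp add: blade_mult blade_sign_def one_clifford_def)

lemma clifford_gen_anticommute:
  assumes "j \<noteq> k"
  shows "clifford_gen j * clifford_gen k + clifford_gen k * clifford_gen j = 0"
  using assms by (auto simp: blade_mult blade_sign_def insert_Diff_if insert_commute)

lemma blade_eq_prod_list: "blade A = prod_list (map clifford_gen (sorted_list_of_set A))"
proof -
  have "blade (set xs) = prod_list (map clifford_gen xs)" if "sorted_wrt (<) xs"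
    for xs :: "'n::{finite,linorder} list"
    using that
  proof (induction xs)
    case Nil
    show ?case by (simp add: one_clifford_def)
  next
    case (Cons x xs)
    then have 1: "sym_diff {x} (set xs) = set (x # xs)" by auto
    have 2: "blade_sign {x} (set xs) = 1"
      using Cons.prems by (auto simp: blade_sign_def intro!: prod.neutral)
    have "blade (set (x # xs)) = clifford_gen x * blade (set xs)"
      by (simp only: blade_mult 1 2 scaleR_one)
    then show ?case using Cons by simp
  qed
  from this[of "sorted_list_of_set A"] show ?thesis by simp
qed

lemma clifford_expansion: "x = (\<Sum>A\<in>UNIV. coeff x A *\<^sub>R blade A)" for x :: "'n::finite clifford"
proof -
  have "coeff (sum f S) B = (\<Sum>A\<in>S. coeff (f A) B)" if "finite S"
    for f :: "'n set \<Rightarrow> 'n clifford" and S B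
    using that by (induction S) auto
  then show ?thesis
    by (simp add: clifford_eq_iff if_distrib cong: if_cong)
qed

instantiation clifford :: (finite) euclidean_space
begin

definition "inner x y = (\<Sum>A\<in>UNIV. coeff x A * coeff y A)"
definition "norm x = sqrt (\<Sum>A\<in>UNIV. (coeff x A)\<^sup>2)" for x :: "'a clifford"
definition "dist x y = norm (x - y)" for x y :: "'a clifford"
definition "sgn x = x /\<^sub>R norm x" for x :: "'a clifford"
definition "uniformity = (INF e\<in>{0<..}. principal {(x, y :: 'a clifford). dist x y < e})"
definition "open U = (\<forall>x\<in>U. eventually (\<lambda>(x', y). x' = x \<longrightarrow> y \<in> U) uniformity)"
  for U :: "'a clifford set"
definition "Basis = range (blade :: 'a set \<Rightarrow> 'a clifford)"

instance
proof
  fix x y z :: "'a clifford" and r :: real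
  show "dist x y = norm (x - y)" by (rule dist_clifford_def)
  show "sgn x = x /\<^sub>R norm x" by (rule sgn_clifford_def)
  show "uniformity = (INF e\<in>{0<..}. principal {(x, y :: 'a clifford). dist x y < e})"
    by (rule uniformity_clifford_def)
  show "open U = (\<forall>x\<in>U. eventually (\<lambda>(x', y). x' = x \<longrightarrow> y \<in> U) uniformity)"
    for U :: "'a clifford set" by (rule open_clifford_def)
  show "inner x y = inner y x"
    by (simp add: inner_clifford_def mult.commute)
  show "inner (x + y) z = inner x z + inner y z"
    by (simp add: inner_clifford_def distrib_right sum.distrib)
  show "inner (r *\<^sub>R x) y = r * inner x y"
    by (simp add: inner_clifford_def sum_distrib_left mult.assoc)
  show "0 \<le> inner x x"
    by (simp add: inner_clifford_def sum_nonneg)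
  show "inner x x = 0 \<longleftrightarrow> x = 0"
    by (simp add: inner_clifford_def sum_nonneg_eq_0_iff clifford_eq_iff)
  show "norm x = sqrt (inner x x)"
    by (simp add: inner_clifford_def norm_clifford_def power2_eq_square)
  show "(Basis :: 'a clifford set) \<noteq> {}" "finite (Basis :: 'a clifford set)"
    by (simp_all add: Basis_clifford_def)
  have blade_inner: "inner w (blade A) = coeff w A" for w :: "'a clifford" and A
    by (simp add: inner_clifford_def if_distrib cong: if_cong)
  show "inner u v = (if u = v then 1 else 0)" if "u \<in> Basis" "v \<in> Basis" for u v :: "'a clifford"
    using that by (auto simp: Basis_clifford_def blade_inner clifford_eq_iff split: if_splits)
  show "(\<forall>u\<in>Basis. inner x u = 0) \<longleftrightarrow> (x = 0)"
    by (auto simp: Basis_clifford_def blade_inner clifford_eq_iff)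
qed

end

lemma DIM_clifford: "DIM('n::finite clifford) = 2 ^ CARD('n)"
proof -
  have "inj (blade :: 'n set \<Rightarrow> 'n clifford)"
    by (rule injI) (metis coeff_blade zero_neq_one)
  then show ?thesis
    by (simp add: Basis_clifford_def card_image card_UNIV_set)
qed

section \<open>Weighted square-integrable functions\<close>

definition is_domain :: "'a::topological_space set \<Rightarrow> bool" where
  "is_domain S \<longleftrightarrow> open S \<and> connected S \<and> S \<noteq> {}"

definition weighted_L2 ::
    "('a::euclidean_space \<Rightarrow> real) \<Rightarrow> 'a set \<Rightarrow> ('a \<Rightarrow> 'b::euclidean_space) set" where
  "weighted_L2 \<phi> S = {u. u \<in> borel_measurable (lebesgue_on S) \<and>
     integrable (lebesgue_on S) (\<lambda>x. (norm (u x))\<^sup>2 * exp (- \<phi> x))}"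

definition weighted_norm_sq ::
    "('a::euclidean_space \<Rightarrow> real) \<Rightarrow> 'a set \<Rightarrow> ('a \<Rightarrow> 'b::euclidean_space) \<Rightarrow> real" where
  "weighted_norm_sq \<phi> S u = (LINT x|lebesgue_on S. (norm (u x))\<^sup>2 * exp (- \<phi> x))"

section \<open>The distributional Laplacian\<close>

definition partial_deriv :: "'n::finite \<Rightarrow> (real^'n \<Rightarrow> real) \<Rightarrow> real^'n \<Rightarrow> real" where
  "partial_deriv j \<psi> x = deriv (\<lambda>t. \<psi> (x + t *\<^sub>R axis j 1)) 0"

definition laplacian :: "(real^'n::finite \<Rightarrow> real) \<Rightarrow> real^'n \<Rightarrow> real" where
  "laplacian \<psi> x = (\<Sum>j\<in>UNIV. partial_deriv j (partial_deriv j \<psi>) x)"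

primrec continuously_differentiable :: "nat \<Rightarrow> (real^'n::finite \<Rightarrow> real) \<Rightarrow> bool" where
  "continuously_differentiable 0 \<psi> \<longleftrightarrow> continuous_on UNIV \<psi>"
| "continuously_differentiable (Suc k) \<psi> \<longleftrightarrow>
     \<psi> differentiable_on UNIV \<and> (\<forall>j. continuously_differentiable k (partial_deriv j \<psi>))"

definition test_functions :: "(real^'n::finite) set \<Rightarrow> (real^'n \<Rightarrow> real) set" where
  "test_functions S = {\<psi>. (\<forall>k. continuously_differentiable k \<psi>) \<and>
     compact (closure {x. \<psi> x \<noteq> 0}) \<and> closure {x. \<psi> x \<noteq> 0} \<subseteq> S}"

definition locally_integrable :: "'a::euclidean_space set \<Rightarrow> ('a \<Rightarrow> 'b::euclidean_space) \<Rightarrow> bool" where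
  "locally_integrable S u \<longleftrightarrow> (\<forall>K. compact K \<and> K \<subseteq> S \<longrightarrow> integrable (lebesgue_on K) u)"

text \<open>
  \<open>u\<close> and \<open>f\<close> are required to be locally integrable, so that they are distributions and the
  (vector-valued) integrals below converge. As the test functions are real-valued, the identity
  amounts to one identity for each component.
\<close>

definition distributional_laplacian ::
    "(real^'n::finite) set \<Rightarrow> (real^'n \<Rightarrow> 'b::euclidean_space) \<Rightarrow> (real^'n \<Rightarrow> 'b) \<Rightarrow> bool" where
  "distributional_laplacian S u f \<longleftrightarrow> locally_integrable S u \<and> locally_integrable S f \<and>
     (\<forall>\<psi>\<in>test_functions S.
        (LINT x|lebesgue_on S. laplacian \<psi> x *\<^sub>R u x) = (LINT x|lebesgue_on S. \<psi> x *\<^sub>R f x))"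

end

theory Submission
  imports Defs
begin

text \<open>
  The equation is solved by duality. Write \<open>n\<close> for the dimension and \<open>\<phi> x = |x|\<^sup>2\<close>. A real-valued
  weak solution of \<open>\<Delta>u = f\<close> is a \<open>u\<close> with \<open>\<integral>u \<Delta>\<psi> = \<integral>f \<psi>\<close> for all test functions \<open>\<psi>\<close>, so what is
  needed is that \<open>\<Delta>\<psi> \<mapsto> \<integral>f \<psi>\<close> is a bounded functional in the norm dual to that of \<open>L\<^sup>2\<^sub>\<phi>\<close>,
  namely the square root of \<open>\<integral>|\<Delta>\<psi>|\<^sup>2 e\<^sup>\<phi>\<close>; the Riesz theorem then produces \<open>u\<close>, with norm
  at most that of the functional. By the Cauchy-Schwarz inequality, boundedness follows from the
  a priori estimate
    \<open>8n \<integral>\<psi>\<^sup>2 e\<^sup>\<phi> \<le> \<integral>|\<Delta>\<psi>|\<^sup>2 e\<^sup>\<phi>\<close>,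
  which is the lemma \<open>weighted_laplacian_lower_bound\<close>. It gives
  \<open>\<parallel>u\<parallel>\<^sup>2 \<le> \<parallel>f\<parallel>\<^sup>2/(8n)\<close>, and \<open>8n \<ge> 16\<close> in dimension at least two.

  The estimate is a commutator computation. With \<open>a\<^sub>j = \<partial>\<^sub>j + x\<^sub>j\<close>, with its adjoint
  \<open>- \<partial>\<^sub>j + x\<^sub>j\<close>, and with \<open>\<beta> = exp (\<phi>/2) \<psi>\<close>, one has
  \<open>\<integral>|\<Delta>\<psi>|\<^sup>2 e\<^sup>\<phi> = \<parallel>T\<^sup>*\<beta>\<parallel>\<^sup>2\<close> for \<open>T = \<Sum>\<^sub>j a\<^sub>j\<^sup>2\<close>; since \<open>a\<^sub>j\<close> and its adjoint have commutator 2,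
    \<open>\<parallel>T\<^sup>*\<beta>\<parallel>\<^sup>2 = \<parallel>T\<beta>\<parallel>\<^sup>2 + 8 \<Sum>\<^sub>j \<parallel>a\<^sub>j\<beta>\<parallel>\<^sup>2 + 8n \<parallel>\<beta>\<parallel>\<^sup>2\<close>.
  Here this is organized so that only derivatives of order two occur: in
  \<open>virial_inequality\<close> the difference of the integrands is recognized as the divergence of an
  explicit vector field plus squares, and that divergence integrates to zero.

  The functional-analytic part is \<open>L2_Riesz_representation\<close>, which minimizes the quadratic
  functional \<open>\<parallel>g\<parallel>\<^sup>2 - 2l\<close> over the pairs \<open>(g, l)\<close> of a vector and the value prescribed on it.
  Functions with values in the Clifford algebra, or in any Euclidean space, are treated one
  coordinate at a time, with the solution 0 chosen for a coordinate of \<open>f\<close> that vanishes.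
  This is why a real-valued \<open>f\<close> gets a real-valued \<open>u\<close>.
\<close>

section \<open>Riesz representation in the space of square-integrable functions\<close>

text \<open>
  This serves twice: for the Cauchy-Schwarz inequality, and to show that an approximate minimizer
  of a quadratic functional is approximately critical.
\<close>

lemma nonneg_quadratic_imp_discriminant:
  fixes a b c :: real
  assumes nonneg: "\<And>t. 0 \<le> a + 2 * b * t + c * t\<^sup>2" and c: "0 \<le> c"
  shows "b\<^sup>2 \<le> a * c"
proof (cases "c = 0")
  case True
  have "b = 0"
  proof (rule ccontr)
    assume b: "b \<noteq> 0"
    have "a + 2 * b * (- (a + 1) / (2 * b)) = - 1" using b by (simp add: field_simps)
    then show False using nonneg[of "- (a + 1) / (2 * b)"] True by simp
  qed
  then show ?thesis using True by simp
next
  case False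
  then have "0 < c" using c by simp
  then have "a + 2 * b * (- b / c) + c * (- b / c)\<^sup>2 = (a * c - b\<^sup>2) / c"
    by (simp add: field_simps power2_eq_square)
  then have "0 \<le> (a * c - b\<^sup>2) / c" using nonneg[of "- b / c"] by simp
  then show ?thesis using \<open>0 < c\<close> by (simp add: zero_le_divide_iff)
qed

definition square_integrable :: "'a measure \<Rightarrow> ('a \<Rightarrow> real) \<Rightarrow> bool" where
  "square_integrable M f \<longleftrightarrow> f \<in> borel_measurable M \<and> integrable M (\<lambda>x. (f x)\<^sup>2)"

lemma square_integrable_mult:
  assumes "square_integrable M f" "square_integrable M g"
  shows "integrable M (\<lambda>x. f x * g x)"
proof (rule Bochner_Integration.integrable_bound)
  show "integrable M (\<lambda>x. (f x)\<^sup>2 + (g x)\<^sup>2)"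
    using assms by (simp add: square_integrable_def)
  show "(\<lambda>x. f x * g x) \<in> borel_measurable M"
    using assms by (auto simp: square_integrable_def intro: borel_measurable_times)
  have "\<bar>a * b\<bar> \<le> a\<^sup>2 + b\<^sup>2" for a b :: real
  proof -
    have "2 * (\<bar>a\<bar> * \<bar>b\<bar>) \<le> a\<^sup>2 + b\<^sup>2"
      using sum_squares_bound[of "\<bar>a\<bar>" "\<bar>b\<bar>"] by (simp add: mult.assoc)
    moreover have "0 \<le> \<bar>a\<bar> * \<bar>b\<bar>" by simp
    ultimately show ?thesis unfolding abs_mult by linarith
  qed
  then show "AE x in M. norm (f x * g x) \<le> norm ((f x)\<^sup>2 + (g x)\<^sup>2)"
    by (intro AE_I2) simp
qed

lemma square_integrable_add_scaled:
  assumes "square_integrable M f" "square_integrable M g"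
  shows "square_integrable M (\<lambda>x. f x + c * g x)"
    and "(LINT x|M. (f x + c * g x)\<^sup>2) =
      (LINT x|M. (f x)\<^sup>2) + 2 * (LINT x|M. f x * g x) * c + (LINT x|M. (g x)\<^sup>2) * c\<^sup>2"
proof -
  have eq: "(\<lambda>x. (f x + c * g x)\<^sup>2) =
      (\<lambda>x. (f x)\<^sup>2 + (2 * c) * (f x * g x) + c\<^sup>2 * (g x)\<^sup>2)"
    by (auto simp: fun_eq_iff power2_eq_square algebra_simps)
  have int: "integrable M (\<lambda>x. (f x)\<^sup>2)" "integrable M (\<lambda>x. (g x)\<^sup>2)"
      "integrable M (\<lambda>x. f x * g x)"
    using assms square_integrable_mult by (auto simp: square_integrable_def)
  show "square_integrable M (\<lambda>x. f x + c * g x)"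
    using assms int by (auto simp: square_integrable_def eq)
  show "(LINT x|M. (f x + c * g x)\<^sup>2) =
      (LINT x|M. (f x)\<^sup>2) + 2 * (LINT x|M. f x * g x) * c + (LINT x|M. (g x)\<^sup>2) * c\<^sup>2"
    using int by (simp add: eq)
qed

lemma square_integrable_diff:
  "square_integrable M f \<Longrightarrow> square_integrable M g \<Longrightarrow> square_integrable M (\<lambda>x. f x - g x)"
  using square_integrable_add_scaled(1)[of M f g "-1"] by simp

lemma integral_Cauchy_Schwarz:
  assumes "square_integrable M f" "square_integrable M g"
  shows "(LINT x|M. f x * g x)\<^sup>2 \<le> (LINT x|M. (f x)\<^sup>2) * (LINT x|M. (g x)\<^sup>2)"
proof (rule nonneg_quadratic_imp_discriminant)
  fix t :: real
  show "0 \<le> (LINT x|M. (f x)\<^sup>2) + 2 * (LINT x|M. f x * g x) * t + (LINT x|M. (g x)\<^sup>2) * t\<^sup>2"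
    unfolding square_integrable_add_scaled(2)[OF assms, symmetric] by simp
qed simp

text \<open>
  Completeness of \<open>L\<^sup>2\<close>, for sequences that converge geometrically fast. With increments \<open>d\<^sub>k\<close>,
  the integrals of \<open>2\<^sup>k d\<^sub>k\<^sup>2\<close> are summable, so \<open>\<Sum>\<^sub>k 2\<^sup>k d\<^sub>k\<^sup>2\<close> is finite almost everywhere. There
  \<open>|d\<^sub>k| \<le> (1/2)\<^sup>k + 2\<^sup>k d\<^sub>k\<^sup>2\<close> is summable too, and the sequence converges pointwise. Fatou's
  lemma turns the Cauchy estimate into the estimate for the limit.
\<close>

lemma geometric_Cauchy_imp_L2_limit:
  fixes s :: "nat \<Rightarrow> 'a \<Rightarrow> real"
  assumes s: "\<And>n. square_integrable M (s n)"
    and cauchy: "\<And>m n. m \<le> n \<Longrightarrow> (LINT x|M. (s n x - s m x)\<^sup>2) \<le> C * (1/4) ^ m"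
  obtains v where "square_integrable M v"
    "\<And>m. (LINT x|M. (v x - s m x)\<^sup>2) \<le> C * (1/4) ^ m"
proof -
  define d where "d k x = s (Suc k) x - s k x" for k x
  have meas[measurable]: "s n \<in> borel_measurable M" for n
    using s by (simp add: square_integrable_def)
  have dmeas[measurable]: "d n \<in> borel_measurable M" for n
    unfolding d_def by measurable
  have nn: "(\<integral>\<^sup>+x. ennreal ((s n x - s m x)\<^sup>2) \<partial>M) \<le> ennreal (C * (1/4) ^ m)" if "m \<le> n" for m n
  proof -
    have "(\<integral>\<^sup>+x. ennreal ((s n x - s m x)\<^sup>2) \<partial>M) = ennreal (LINT x|M. (s n x - s m x)\<^sup>2)"
      using square_integrable_diff[OF s s]
      by (intro nn_integral_eq_integral) (auto simp: square_integrable_def)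
    then show ?thesis using cauchy[OF that] by (simp add: ennreal_leI)
  qed
  have "0 \<le> C"
    using cauchy[of 0 0] by simp
  have "AE x in M. (\<Sum>k. ennreal (2 ^ k * (d k x)\<^sup>2)) \<noteq> \<infinity>"
  proof (rule nn_integral_PInf_AE)
    show "(\<lambda>x. \<Sum>k. ennreal (2 ^ k * (d k x)\<^sup>2)) \<in> borel_measurable M" by measurable
    have "(\<integral>\<^sup>+x. ennreal (2 ^ k * (d k x)\<^sup>2) \<partial>M) \<le> ennreal (C * (1/2) ^ k)" for k
    proof -
      have "(\<integral>\<^sup>+x. ennreal (2 ^ k * (d k x)\<^sup>2) \<partial>M) = ennreal (2 ^ k) * (\<integral>\<^sup>+x. ennreal ((d k x)\<^sup>2) \<partial>M)"
        by (subst nn_integral_cmult[symmetric]) (auto simp: ennreal_mult')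
      also have "\<dots> \<le> ennreal (2 ^ k) * ennreal (C * (1/4) ^ k)"
        unfolding d_def by (intro mult_left_mono nn) auto
      also have "\<dots> = ennreal (2 ^ k * (C * (1/4) ^ k))"
        by (rule ennreal_mult'[symmetric]) simp
      also have "2 ^ k * (C * (1/4) ^ k) = C * ((2 * (1/4)) ^ k :: real)"
        by (simp only: power_mult_distrib ac_simps)
      finally show ?thesis by simp
    qed
    then have "(\<Sum>k. \<integral>\<^sup>+x. ennreal (2 ^ k * (d k x)\<^sup>2) \<partial>M) \<le> (\<Sum>k. ennreal (C * (1/2) ^ k))"
      by (intro suminf_le) auto
    also have "\<dots> = ennreal (\<Sum>k. C * (1/2) ^ k)"
      using \<open>0 \<le> C\<close> by (intro suminf_ennreal2 summable_mult summable_geometric) auto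
    finally have "(\<Sum>k. \<integral>\<^sup>+x. ennreal (2 ^ k * (d k x)\<^sup>2) \<partial>M) < \<infinity>"
      by (simp add: le_less_trans)
    then show "(\<integral>\<^sup>+x. (\<Sum>k. ennreal (2 ^ k * (d k x)\<^sup>2)) \<partial>M) \<noteq> \<infinity>"
      by (subst nn_integral_suminf) auto
  qed
  then have conv: "AE x in M. convergent (\<lambda>n. s n x)"
  proof eventually_elim
    case (elim x)
    have "summable (\<lambda>k. 2 ^ k * (d k x)\<^sup>2)"
      using elim by (intro summable_suminf_not_top) auto
    then have sum: "summable (\<lambda>k. (1/2) ^ k + 2 ^ k * (d k x)\<^sup>2)"
      by (intro summable_add summable_geometric) auto
    have "norm (d k x) \<le> (1/2) ^ k + 2 ^ k * (d k x)\<^sup>2" for k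
    proof (cases "\<bar>d k x\<bar> \<le> (1/2) ^ k")
      case True
      then show ?thesis by (simp add: add_increasing2)
    next
      case False
      have "\<bar>d k x\<bar> = 2 ^ k * ((1/2) ^ k * \<bar>d k x\<bar>)" by (simp add: power_one_over)
      also have "\<dots> \<le> 2 ^ k * (\<bar>d k x\<bar> * \<bar>d k x\<bar>)"
        using False by (intro mult_left_mono mult_right_mono) auto
      also have "\<dots> = 2 ^ k * (d k x)\<^sup>2" by (simp add: power2_eq_square)
      finally show ?thesis by (simp add: add_increasing)
    qed
    then have "summable (\<lambda>k. d k x)"
      by (intro summable_comparison_test'[OF sum]) auto
    then have "convergent (\<lambda>n. s 0 x + (\<Sum>k<n. d k x))"
      by (intro convergent_add convergent_const) (simp add: summable_iff_convergent)
    then show ?case by (simp add: d_def sum_lessThan_telescope[of "\<lambda>k. s k x"])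
  qed
  define v where "v x = lim (\<lambda>n. s n x)" for x
  have vmeas[measurable]: "v \<in> borel_measurable M"
    unfolding v_def by measurable
  have vnn: "(\<integral>\<^sup>+x. ennreal ((v x - s m x)\<^sup>2) \<partial>M) \<le> ennreal (C * (1/4) ^ m)" for m
  proof -
    have "AE x in M. ennreal ((v x - s m x)\<^sup>2) = liminf (\<lambda>n. ennreal ((s n x - s m x)\<^sup>2))"
      using conv
    proof eventually_elim
      case (elim x)
      then have "(\<lambda>n. s n x) \<longlonglongrightarrow> v x" unfolding v_def by (simp add: convergent_LIMSEQ_iff)
      then have "(\<lambda>n. ennreal ((s n x - s m x)\<^sup>2)) \<longlonglongrightarrow> ennreal ((v x - s m x)\<^sup>2)"
        by (intro tendsto_intros)
      then show ?case by (intro lim_imp_Liminf[symmetric]) auto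
    qed
    then have "(\<integral>\<^sup>+x. ennreal ((v x - s m x)\<^sup>2) \<partial>M) =
        (\<integral>\<^sup>+x. liminf (\<lambda>n. ennreal ((s n x - s m x)\<^sup>2)) \<partial>M)"
      by (rule nn_integral_cong_AE)
    also have "\<dots> \<le> liminf (\<lambda>n. \<integral>\<^sup>+x. ennreal ((s n x - s m x)\<^sup>2) \<partial>M)"
      by (rule nn_integral_liminf) measurable
    also have "\<dots> \<le> ennreal (C * (1/4) ^ m)"
      by (rule Liminf_le) (auto intro!: eventually_sequentiallyI[of m] nn)
    finally show ?thesis .
  qed
  have diff: "square_integrable M (\<lambda>x. v x - s m x)" for m
    unfolding square_integrable_def
  proof (intro conjI integrableI_nonneg)
    show "(\<integral>\<^sup>+x. ennreal ((v x - s m x)\<^sup>2) \<partial>M) < \<infinity>"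
      using vnn[of m] by (simp add: le_less_trans)
  qed auto
  show ?thesis
  proof
    show "square_integrable M v"
      using square_integrable_add_scaled(1)[OF diff[of 0] s[of 0], of 1] by simp
    fix m
    have "ennreal (LINT x|M. (v x - s m x)\<^sup>2) = (\<integral>\<^sup>+x. ennreal ((v x - s m x)\<^sup>2) \<partial>M)"
      using diff[of m] by (intro nn_integral_eq_integral[symmetric]) (auto simp: square_integrable_def)
    also note vnn[of m]
    finally show "(LINT x|M. (v x - s m x)\<^sup>2) \<le> C * (1/4) ^ m"
      using \<open>0 \<le> C\<close> by (subst (asm) ennreal_le_iff) auto
  qed
qed

lemma nonpos_if_le_geometric:
  fixes a K r :: real
  assumes "\<And>k. a \<le> K * r ^ k" "0 \<le> r" "r < 1"
  shows "a \<le> 0"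
proof (rule LIMSEQ_le_const)
  show "(\<lambda>k. K * r ^ k) \<longlonglongrightarrow> 0"
    using assms by (intro tendsto_mult_right_zero LIMSEQ_power_zero) simp
qed (use assms in auto)

text \<open>
  The functional is given by its graph \<open>S\<close>, a linear relation between square-integrable functions
  and reals; the bound makes the value depend only on the function up to null sets. The minimizer of
  \<open>\<parallel>g\<parallel>\<^sup>2 - 2l\<close> over \<open>S\<close> would represent the functional, and a minimizing sequence suffices: if
  \<open>(g, l)\<close> is within \<open>\<epsilon>\<close> of the infimum, then moving in a direction \<open>(h, m)\<close> shows that
  \<open>(\<langle>g, h\<rangle> - m)\<^sup>2 \<le> \<epsilon> \<parallel>h\<parallel>\<^sup>2\<close>. Applied to \<open>h\<close> equal to the difference of two members of the sequence,
  this makes the sequence Cauchy; applied to fixed \<open>h\<close>, it shows that the limit represents the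
  functional.
\<close>

lemma L2_Riesz_representation:
  fixes S :: "(('a \<Rightarrow> real) \<times> real) set"
  assumes nonempty: "S \<noteq> {}"
    and L2: "\<And>g l. (g, l) \<in> S \<Longrightarrow> square_integrable M g"
    and linear: "\<And>g l h m c. (g, l) \<in> S \<Longrightarrow> (h, m) \<in> S \<Longrightarrow> (\<lambda>x. g x + c * h x, l + c * m) \<in> S"
    and bounded: "\<And>g l. (g, l) \<in> S \<Longrightarrow> l\<^sup>2 \<le> C * (LINT x|M. (g x)\<^sup>2)"
    and C: "0 \<le> C"
  obtains v where "square_integrable M v"
    "\<And>g l. (g, l) \<in> S \<Longrightarrow> (LINT x|M. v x * g x) = l"
    "(LINT x|M. (v x)\<^sup>2) \<le> C"
proof -
  define N where "N g = (LINT x|M. (g x)\<^sup>2)" for g :: "'a \<Rightarrow> real"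
  define J where "J p = N (fst p) - 2 * snd p" for p
  define \<mu> where "\<mu> = Inf (J ` S)"
  have N_nonneg: "0 \<le> N g" for g by (simp add: N_def)
  have Cauchy_Schwarz: "\<bar>LINT x|M. f x * g x\<bar> \<le> sqrt (N f) * sqrt (N g)"
    if "square_integrable M f" "square_integrable M g" for f g
  proof -
    have "\<bar>LINT x|M. f x * g x\<bar> \<le> sqrt (N f * N g)"
      unfolding N_def by (rule real_le_rsqrt) (simp add: integral_Cauchy_Schwarz[OF that])
    then show ?thesis by (simp only: real_sqrt_mult)
  qed
  \<comment> \<open>By the bound on the functional, \<open>2l \<le> 2 sqrt (C N) \<le> C + N\<close>.\<close>
  have J_bound: "- C \<le> N g - 2 * l" if "(g, l) \<in> S" for g l
  proof -
    have "(2 * l)\<^sup>2 = 4 * l\<^sup>2" by (simp add: power2_eq_square)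
    also have "\<dots> \<le> 4 * (C * N g)" using bounded[OF that] unfolding N_def by linarith
    also have "\<dots> = (C + N g)\<^sup>2 - (C - N g)\<^sup>2" by algebra
    also have "\<dots> \<le> (C + N g)\<^sup>2" by simp
    finally have "2 * l \<le> C + N g"
      by (rule power2_le_imp_le) (use C N_nonneg[of g] in linarith)
    then show ?thesis by linarith
  qed
  have bdd: "bdd_below (J ` S)"
    using J_bound by (intro bdd_belowI[of _ "- C"]) (auto simp: J_def)
  have \<mu>_le: "\<mu> \<le> N g - 2 * l" if "(g, l) \<in> S" for g l
    unfolding \<mu>_def using cInf_lower[OF imageI[OF that, of J] bdd] by (simp add: J_def)
  have "\<exists>p. p \<in> S \<and> J p < \<mu> + (1/4) ^ k" for k :: nat
    using cInf_lessD[of "J ` S" "\<mu> + (1/4) ^ k"] nonempty unfolding \<mu>_def by auto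
  then obtain p where p: "\<And>k. p k \<in> S" "\<And>k::nat. J (p k) < \<mu> + (1/4) ^ k" by metis
  define s where "s k = fst (p k)" for k
  define l where "l k = snd (p k)" for k
  have sS: "(s k, l k) \<in> S" for k using p(1)[of k] by (simp add: s_def l_def)
  have sL2: "square_integrable M (s k)" for k using L2[OF sS] .
  have almost_critical: "\<bar>(LINT x|M. s k x * h x) - m\<bar> \<le> (1/2) ^ k * sqrt (N h)"
    if h: "(h, m) \<in> S" for h m k
  proof -
    have "((LINT x|M. s k x * h x) - m)\<^sup>2 \<le> (1/4) ^ k * N h"
    proof (rule nonneg_quadratic_imp_discriminant)
      fix t :: real
      have "\<mu> \<le> N (\<lambda>x. s k x + t * h x) - 2 * (l k + t * m)"
        by (rule \<mu>_le[OF linear[OF sS h]])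
      also have "N (\<lambda>x. s k x + t * h x) = N (s k) + 2 * (LINT x|M. s k x * h x) * t + N h * t\<^sup>2"
        unfolding N_def by (rule square_integrable_add_scaled(2)[OF sL2 L2[OF h]])
      finally show "0 \<le> (1/4) ^ k + 2 * ((LINT x|M. s k x * h x) - m) * t + N h * t\<^sup>2"
        using p(2)[of k] by (simp add: J_def s_def l_def algebra_simps)
    qed (rule N_nonneg)
    then have "\<bar>(LINT x|M. s k x * h x) - m\<bar> \<le> sqrt ((1/4) ^ k * N h)"
      by (simp add: real_le_rsqrt)
    also have "sqrt ((1/4) ^ k * N h) = (1/2) ^ k * sqrt (N h)"
      by (simp add: real_sqrt_mult real_sqrt_power real_sqrt_divide)
    finally show ?thesis .
  qed
  have cauchy: "(LINT x|M. (s n x - s m x)\<^sup>2) \<le> 4 * (1/4) ^ m" if "m \<le> n" for m n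
  proof -
    define h where "h x = s n x - s m x" for x
    have hS: "(h, l n - l m) \<in> S"
      using linear[OF sS sS, of n "-1" m] by (simp add: h_def[abs_def])
    have "N h = (LINT x|M. s n x * h x - s m x * h x)"
      unfolding N_def h_def by (simp add: power2_eq_square algebra_simps)
    also have "\<dots> = (LINT x|M. s n x * h x) - (LINT x|M. s m x * h x)"
      using square_integrable_mult[OF sL2 L2[OF hS]] by simp
    also have "\<dots> \<le> ((1/2) ^ n + (1/2) ^ m) * sqrt (N h)"
      using almost_critical[OF hS, of n] almost_critical[OF hS, of m]
      by (simp add: algebra_simps abs_le_iff)
    also have "\<dots> \<le> (2 * (1/2) ^ m) * sqrt (N h)"
      using power_decreasing[OF that, of "1/2::real"] by (intro mult_right_mono) (auto simp: N_nonneg)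
    finally have "sqrt (N h) * sqrt (N h) \<le> (2 * (1/2) ^ m) * sqrt (N h)"
      by (simp add: N_nonneg)
    then have "sqrt (N h) \<le> 2 * (1/2) ^ m"
    proof (cases "N h = 0")
      case False
      then have "0 < sqrt (N h)" using N_nonneg[of h] by simp
      then show ?thesis
        using \<open>sqrt (N h) * sqrt (N h) \<le> (2 * (1/2) ^ m) * sqrt (N h)\<close> by (rule mult_right_le_imp_le[rotated])
    qed simp
    then have "(sqrt (N h))\<^sup>2 \<le> (2 * (1/2) ^ m)\<^sup>2"
      by (intro power_mono) (auto simp: N_nonneg)
    moreover have "(2 * (1/2) ^ m)\<^sup>2 = 4 * (1/4 :: real) ^ m"
      by (induction m) (simp_all add: power2_eq_square)
    ultimately show ?thesis
      by (simp add: N_nonneg) (simp add: N_def h_def)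
  qed
  obtain v where v: "square_integrable M v"
    and v_near: "\<And>m. (LINT x|M. (v x - s m x)\<^sup>2) \<le> 4 * (1/4) ^ m"
    using geometric_Cauchy_imp_L2_limit[OF sL2 cauchy] by metis
  have represents: "(LINT x|M. v x * h x) = m" if h: "(h, m) \<in> S" for h m
  proof -
    have "\<bar>(LINT x|M. v x * h x) - m\<bar> \<le> 3 * sqrt (N h) * (1/2) ^ k" for k
    proof -
      have diff: "square_integrable M (\<lambda>x. v x - s k x)" by (rule square_integrable_diff[OF v sL2])
      have "(LINT x|M. v x * h x) - (LINT x|M. s k x * h x) = (LINT x|M. (v x - s k x) * h x)"
        using square_integrable_mult[OF v L2[OF h]] square_integrable_mult[OF sL2 L2[OF h]]
        by (simp add: left_diff_distrib)
      moreover have "\<bar>LINT x|M. (v x - s k x) * h x\<bar> \<le> 2 * (1/2) ^ k * sqrt (N h)"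
      proof -
        have "sqrt (N (\<lambda>x. v x - s k x)) \<le> sqrt (4 * (1/4) ^ k)"
          using v_near[of k] by (simp add: N_def)
        also have "\<dots> = 2 * (1/2) ^ k"
          by (simp add: real_sqrt_mult real_sqrt_power real_sqrt_divide)
        finally show ?thesis
          using Cauchy_Schwarz[OF diff L2[OF h]] N_nonneg[of h]
          by (meson mult_right_mono order_trans real_sqrt_ge_zero)
      qed
      ultimately show ?thesis using almost_critical[OF h, of k] by (simp add: algebra_simps)
    qed
    from nonpos_if_le_geometric[OF this] show ?thesis by simp
  qed
  show ?thesis
  proof (rule that[OF v represents])
    \<comment> \<open>\<open>v\<close> represents the functional, so \<open>\<langle>v, s\<^sub>k\<rangle> = l\<^sub>k\<close>; expanding \<open>\<parallel>v - s\<^sub>k\<parallel>\<^sup>2\<close> compares \<open>\<parallel>v\<parallel>\<^sup>2\<close> with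
      minus the value of the functional at \<open>s\<^sub>k\<close>, which is at most \<open>C\<close>.\<close>
    have "N v - C \<le> 4 * (1/4) ^ k" for k
    proof -
      have "(LINT x|M. (v x - s k x)\<^sup>2) = N v - 2 * l k + N (s k)"
        using square_integrable_add_scaled(2)[OF v sL2, of "-1" k] by (simp add: N_def represents[OF sS])
      then show ?thesis using v_near[of k] J_bound[OF sS, of k] by simp
    qed
    from nonpos_if_le_geometric[OF this] show "(LINT x|M. (v x)\<^sup>2) \<le> C" by (simp add: N_def)
  qed
qed

section \<open>Partial derivatives and integration by parts\<close>

text \<open>
  The relational form of a partial derivative lets the product, sum and chain rules be applied
  without proving first that the functions involved are differentiable.
\<close>

definition has_partial :: "'n::finite \<Rightarrow> (real^'n \<Rightarrow> real) \<Rightarrow> (real^'n \<Rightarrow> real) \<Rightarrow> bool" where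
  "has_partial j f f' \<longleftrightarrow>
    (\<forall>x. ((\<lambda>t. f (x + t *\<^sub>R axis j 1)) has_real_derivative f' x) (at 0))"

lemma has_partial_along_line:
  assumes "has_partial j f f'"
  shows "((\<lambda>t. f (x + t *\<^sub>R axis j 1)) has_real_derivative f' (x + t *\<^sub>R axis j 1)) (at t)"
proof -
  have "((\<lambda>s. f ((x + t *\<^sub>R axis j 1) + s *\<^sub>R axis j 1)) has_real_derivative
      f' (x + t *\<^sub>R axis j 1)) (at 0)"
    using assms by (auto simp: has_partial_def)
  then have "((\<lambda>s. f (x + (s + t) *\<^sub>R axis j 1)) has_real_derivative
      f' (x + t *\<^sub>R axis j 1)) (at 0)"
    by (simp add: algebra_simps)
  then show ?thesis
    using DERIV_shift[of "\<lambda>s. f (x + s *\<^sub>R axis j 1)" _ 0 t] by (simp add: add.commute)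
qed

lemma has_partial_mvt:
  assumes "has_partial j f f'" "0 < h"
  obtains s where "0 < s" "s < h" "f (x + h *\<^sub>R axis j 1) - f x = h * f' (x + s *\<^sub>R axis j 1)"
proof -
  have "\<exists>s. 0 < s \<and> s < h \<and> f (x + h *\<^sub>R axis j 1) - f (x + 0 *\<^sub>R axis j 1) =
      (h - 0) * f' (x + s *\<^sub>R axis j 1)"
    using assms by (intro MVT2 has_partial_along_line)
  then show ?thesis using that by auto
qed

lemma has_partial_translate:
  assumes "has_partial j f f'"
  shows "has_partial j (\<lambda>x. f (x + c)) (\<lambda>x. f' (x + c))"
  unfolding has_partial_def
proof
  fix x
  have "((\<lambda>t. f ((x + c) + t *\<^sub>R axis j 1)) has_real_derivative f' (x + c)) (at 0)"
    using assms by (auto simp: has_partial_def)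
  then show "((\<lambda>t. f (x + t *\<^sub>R axis j 1 + c)) has_real_derivative f' (x + c)) (at 0)"
    by (simp add: ac_simps)
qed

lemma has_partial_diff:
  "has_partial j f f' \<Longrightarrow> has_partial j g g' \<Longrightarrow> has_partial j (\<lambda>x. f x - g x) (\<lambda>x. f' x - g' x)"
  unfolding has_partial_def by (auto intro: DERIV_diff)

text \<open>
  Two mean value theorems turn the second difference over a square of side \<open>h\<close> into a mixed
  partial derivative at a nearby point. The second difference is symmetric in the two directions,
  so both orders of differentiation can be read off from it as \<open>h \<rightarrow> 0\<close>; this is how
  \<open>mixed_partials_eq\<close> below is obtained.
\<close>

lemma double_mvt:
  assumes "has_partial j f fj" "has_partial k fj fjk" "0 < h"
  obtains s t where "0 < s" "s < h" "0 < t" "t < h"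
    "f (x + h *\<^sub>R axis j 1 + h *\<^sub>R axis k 1) - f (x + h *\<^sub>R axis j 1) - f (x + h *\<^sub>R axis k 1) + f x
      = h\<^sup>2 * fjk (x + s *\<^sub>R axis j 1 + t *\<^sub>R axis k 1)"
proof -
  have "has_partial j (\<lambda>x. f (x + h *\<^sub>R axis k 1) - f x) (\<lambda>x. fj (x + h *\<^sub>R axis k 1) - fj x)"
    by (intro has_partial_diff has_partial_translate assms)
  from has_partial_mvt[OF this \<open>0 < h\<close>, of x] obtain s where s: "0 < s" "s < h"
    "f (x + h *\<^sub>R axis j 1 + h *\<^sub>R axis k 1) - f (x + h *\<^sub>R axis j 1)
      - (f (x + h *\<^sub>R axis k 1) - f x) =
     h * (fj (x + s *\<^sub>R axis j 1 + h *\<^sub>R axis k 1) - fj (x + s *\<^sub>R axis j 1))"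
    by metis
  from has_partial_mvt[OF assms(2,3), of "x + s *\<^sub>R axis j 1"] obtain t where t: "0 < t" "t < h"
    "fj (x + s *\<^sub>R axis j 1 + h *\<^sub>R axis k 1) - fj (x + s *\<^sub>R axis j 1) =
      h * fjk (x + s *\<^sub>R axis j 1 + t *\<^sub>R axis k 1)"
    by metis
  show ?thesis
    using that[OF s(1,2) t(1,2)] s(3) t(3) by (simp add: power2_eq_square)
qed

lemma mixed_partials_eq:
  assumes "has_partial j f fj" "has_partial k f fk" "has_partial k fj fjk" "has_partial j fk fkj"
    and cont: "continuous_on UNIV fjk" "continuous_on UNIV fkj"
  shows "fjk x = fkj x"
proof -
  let ?e = "\<lambda>n. 1 / real (Suc n)"
  let ?p = "\<lambda>s t. x + s *\<^sub>R axis j 1 + t *\<^sub>R axis k 1"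
  have "\<exists>s t s' t'. 0 < s \<and> s < ?e n \<and> 0 < t \<and> t < ?e n \<and> 0 < s' \<and> s' < ?e n \<and> 0 < t' \<and> t' < ?e n \<and>
      fjk (?p s t) = fkj (?p s' t')" for n
  proof -
    have e: "0 < ?e n" by simp
    have comm: "x + a + b = x + b + a" for a b by (simp add: ac_simps)
    obtain s t where st: "0 < s" "s < ?e n" "0 < t" "t < ?e n"
      "f (x + ?e n *\<^sub>R axis j 1 + ?e n *\<^sub>R axis k 1) - f (x + ?e n *\<^sub>R axis j 1)
        - f (x + ?e n *\<^sub>R axis k 1) + f x = (?e n)\<^sup>2 * fjk (?p s t)"
      by (rule double_mvt[OF assms(1,3) e])
    \<comment> \<open>The same square, traversed in the other order.\<close>
    obtain t' s' where st': "0 < t'" "t' < ?e n" "0 < s'" "s' < ?e n"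
      "f (x + ?e n *\<^sub>R axis k 1 + ?e n *\<^sub>R axis j 1) - f (x + ?e n *\<^sub>R axis k 1)
        - f (x + ?e n *\<^sub>R axis j 1) + f x = (?e n)\<^sup>2 * fkj (x + t' *\<^sub>R axis k 1 + s' *\<^sub>R axis j 1)"
      by (rule double_mvt[OF assms(2,4) e])
    have "(?e n)\<^sup>2 * fjk (?p s t) = (?e n)\<^sup>2 * fkj (?p s' t')"
      using st(5) st'(5)[unfolded comm[of "?e n *\<^sub>R axis k 1" "?e n *\<^sub>R axis j 1"]
        comm[of "t' *\<^sub>R axis k 1" "s' *\<^sub>R axis j 1"]] by linarith
    then have "fjk (?p s t) = fkj (?p s' t')" by simp
    then show ?thesis using st st' by blast
  qed
  then obtain s t s' t' where st: "\<And>n. 0 < s n" "\<And>n. s n < ?e n" "\<And>n. 0 < t n" "\<And>n. t n < ?e n"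
    "\<And>n. 0 < s' n" "\<And>n. s' n < ?e n" "\<And>n. 0 < t' n" "\<And>n. t' n < ?e n"
    "\<And>n. fjk (?p (s n) (t n)) = fkj (?p (s' n) (t' n))"
    by metis
  have zero: "a \<longlonglongrightarrow> 0" if "\<And>n. 0 < a n" "\<And>n. a n < ?e n" for a :: "nat \<Rightarrow> real"
    by (rule tendsto_sandwich[OF _ _ tendsto_const LIMSEQ_Suc[OF lim_1_over_n]])
      (use that in \<open>auto intro!: always_eventually less_imp_le\<close>)
  have lim: "(\<lambda>n. g (?p (a n) (b n))) \<longlonglongrightarrow> g x"
    if "continuous_on UNIV g" "a \<longlonglongrightarrow> 0" "b \<longlonglongrightarrow> 0" for g :: "real^'a \<Rightarrow> real" and a b
  proof -
    have "(\<lambda>n. ?p (a n) (b n)) \<longlonglongrightarrow> ?p 0 0"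
      using that by (intro tendsto_intros)
    then show ?thesis
      using that(1) by (intro continuous_on_tendsto_compose[OF that(1)]) auto
  qed
  have "(\<lambda>n. fjk (?p (s n) (t n))) \<longlonglongrightarrow> fjk x" "(\<lambda>n. fkj (?p (s' n) (t' n))) \<longlonglongrightarrow> fkj x"
    by (intro lim cont zero st)+
  then show ?thesis using st(9) LIMSEQ_unique by auto
qed

lemma has_partial_zero_outside_ball:
  assumes "has_partial j f f'" and zero: "\<And>x. R < norm x \<Longrightarrow> f x = 0" and x: "R < norm x"
  shows "f' x = 0"
proof -
  have "((\<lambda>t. x + t *\<^sub>R axis j 1) \<longlongrightarrow> x + 0 *\<^sub>R axis j 1) (nhds 0)"
    by (intro tendsto_intros filterlim_ident)
  then have "((\<lambda>t. norm (x + t *\<^sub>R axis j 1)) \<longlongrightarrow> norm x) (nhds 0)"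
    by (simp add: tendsto_norm)
  then have "\<forall>\<^sub>F t in nhds 0. R < norm (x + t *\<^sub>R axis j 1)"
    using x by (rule order_tendstoD)
  then have ev: "\<forall>\<^sub>F t in nhds 0. f (x + t *\<^sub>R axis j 1) = 0"
    by eventually_elim (rule zero)
  have "((\<lambda>t. f (x + t *\<^sub>R axis j 1)) has_real_derivative f' x) (at 0)"
    using assms by (auto simp: has_partial_def)
  then have "((\<lambda>t. 0) has_real_derivative f' x) (at 0)"
    using DERIV_cong_ev[OF refl ev refl] by simp
  then show ?thesis using DERIV_unique[OF _ DERIV_const] by blast
qed

lemma integrable_continuous_zero_outside_ball:
  fixes f :: "real^'n::finite \<Rightarrow> real"
  assumes "continuous_on UNIV f" and zero: "\<And>x. R < norm x \<Longrightarrow> f x = 0"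
  shows "integrable lborel f"
proof -
  have "integrable lborel (\<lambda>x. indicator (cball 0 R) x *\<^sub>R f x)"
    using assms(1) by (intro borel_integrable_compact) (auto intro: continuous_on_subset)
  also have "(\<lambda>x. indicator (cball 0 R) x *\<^sub>R f x) = f"
    using zero by (auto simp: fun_eq_iff indicator_def dist_norm)
  finally show ?thesis .
qed

text \<open>
  Integration by parts in its simplest form. By translation invariance every difference quotient of
  \<open>f\<close> has integral 0. The quotients converge to \<open>f'\<close> and are dominated: the mean value theorem
  bounds them by the maximum of \<open>|f'|\<close>, and steps of length at most 1 keep their support in the
  ball of radius \<open>R + 1\<close>.
\<close>

lemma integral_partial_eq_0:
  fixes f :: "real^'n::finite \<Rightarrow> real"
  assumes f: "has_partial j f f'" and cont: "continuous_on UNIV f" "continuous_on UNIV f'"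
    and zero: "\<And>x. R < norm x \<Longrightarrow> f x = 0"
  shows "(LINT x|lborel. f' x) = 0"
proof -
  let ?e = "\<lambda>n. 1 / real (Suc n)"
  define s where "s n x = (f (x + ?e n *\<^sub>R axis j 1) - f x) / ?e n" for n x
  have "compact (f' ` cball 0 R)"
    using cont by (intro compact_continuous_image) (auto intro: continuous_on_subset)
  then obtain B where "0 < B" and B': "\<And>y. y \<in> f' ` cball 0 R \<Longrightarrow> norm y \<le> B"
    using compact_imp_bounded bounded_pos by (metis (no_types, lifting))
  have B: "\<bar>f' x\<bar> \<le> B" for x
  proof (cases "norm x \<le> R")
    case True
    then show ?thesis using B'[of "f' x"] by (auto simp: dist_norm)
  next
    case False
    then show ?thesis using has_partial_zero_outside_ball[OF f zero, where x = x] \<open>0 < B\<close> by simp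
  qed
  have int_f: "integrable lborel f"
    by (rule integrable_continuous_zero_outside_ball[OF cont(1) zero])
  have fmeas[measurable]: "f \<in> borel_measurable borel" "f' \<in> borel_measurable borel"
    using cont by (auto intro: borel_measurable_continuous_onI)
  have "(\<lambda>n. LINT x|lborel. s n x) \<longlonglongrightarrow> (LINT x|lborel. f' x)"
  proof (rule integral_dominated_convergence)
    show "integrable lborel (\<lambda>x :: real^'n. indicator (cball 0 (R + 1)) x * B)"
      using borel_integrable_compact[of "cball (0::real^'n) (R + 1)" "\<lambda>_. B"] by simp
    show "AE x in lborel. (\<lambda>n. s n x) \<longlonglongrightarrow> f' x"
    proof (rule AE_I2)
      fix x
      have "((\<lambda>h. (f (x + h *\<^sub>R axis j 1) - f x) / h) \<longlongrightarrow> f' x) (at 0)"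
        using f unfolding has_partial_def DERIV_def by simp
      moreover have "filterlim ?e (at 0) sequentially"
        unfolding filterlim_at using LIMSEQ_Suc[OF lim_1_over_n] by (auto intro!: always_eventually)
      ultimately show "(\<lambda>n. s n x) \<longlonglongrightarrow> f' x"
        unfolding s_def by (rule filterlim_compose)
    qed
    show "AE x in lborel. norm (s n x) \<le> indicator (cball 0 (R + 1)) x * B" for n
    proof (rule AE_I2)
      fix x
      show "norm (s n x) \<le> indicator (cball 0 (R + 1)) x * B"
      proof (cases "norm x \<le> R + 1")
        case True
        obtain t where "f (x + ?e n *\<^sub>R axis j 1) - f x = ?e n * f' (x + t *\<^sub>R axis j 1)"
          using has_partial_mvt[OF f, of "?e n"] by (metis divide_pos_pos of_nat_0_less_iff zero_less_Suc zero_less_one)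
        then have "s n x = f' (x + t *\<^sub>R axis j 1)" by (simp add: s_def)
        then show ?thesis using B True by (simp add: dist_norm)
      next
        case False
        have "norm x \<le> norm (x + ?e n *\<^sub>R axis j 1) + norm (?e n *\<^sub>R axis j (1::real))"
          using norm_triangle_ineq4[of "x + ?e n *\<^sub>R axis j 1" "?e n *\<^sub>R axis j 1"] by simp
        moreover have "norm (?e n *\<^sub>R axis j (1::real)) \<le> 1"
          by simp
        ultimately have "R < norm (x + ?e n *\<^sub>R axis j 1)"
          using False by linarith
        then have "f (x + ?e n *\<^sub>R axis j 1) = 0" "f x = 0"
          using False by (auto intro: zero)
        then show ?thesis using False by (simp add: s_def)
      qed
    qed
    show "s n \<in> borel_measurable lborel" for n
      unfolding s_def by measurable
  qed measurable
  moreover have "(LINT x|lborel. s n x) = 0" for n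
  proof -
    have dist: "lborel = distr lborel borel ((+) (?e n *\<^sub>R axis j 1 :: real^'n))"
      by (rule lborel_distr_plus[symmetric])
    have int: "integrable lborel (\<lambda>x. f (?e n *\<^sub>R axis j 1 + x))"
      using int_f by (subst (asm) dist) (simp add: integrable_distr_eq)
    have "(LINT x|lborel. f x) = (LINT x|lborel. f (?e n *\<^sub>R axis j 1 + x))"
      by (subst dist) (simp add: integral_distr)
    then show ?thesis
      using int int_f by (simp add: s_def add.commute)
  qed
  ultimately show ?thesis by (simp add: LIMSEQ_const_iff)
qed

section \<open>A virial inequality for the Laplacian conjugated with a Gaussian\<close>

text \<open>
  The pointwise inequality behind the a priori estimate, written with numbers: \<open>\<beta>\<close>, \<open>q j\<close> and \<open>h j k\<close>
  stand for the value, the gradient and the Hessian of a function at the point \<open>x\<close>. Put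
  \<open>P = \<Delta>\<beta> + |x|\<^sup>2\<beta>\<close> and \<open>Q = 2 x\<cdot>\<nabla>\<beta> + n\<beta>\<close>, so that the square on the right is \<open>(P - Q)\<^sup>2\<close>, which is at
  least \<open>- 4PQ\<close>. The left-hand side is the divergence of
    \<open>- 4 (2 (x\<cdot>\<nabla>\<beta>) \<nabla>\<beta> - |\<nabla>\<beta>|\<^sup>2 x + n \<beta> \<nabla>\<beta> + \<beta>\<^sup>2 |x|\<^sup>2 x) - 8 \<beta>\<^sup>2 x\<close>.
  Its first part is the Pohozaev (virial) field, with divergence
  \<open>- 4PQ - 8|\<nabla>\<beta>|\<^sup>2 - 8|x|\<^sup>2\<beta>\<^sup>2\<close>; the last term completes \<open>|\<nabla>\<beta>|\<^sup>2 + |x|\<^sup>2\<beta>\<^sup>2\<close> to the square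
  \<open>|\<nabla>\<beta> + \<beta>x|\<^sup>2\<close> at the cost of the constant \<open>8n\<close>. The symmetry of the Hessian makes the terms \<open>x\<^sub>k h\<^sub>k\<^sub>j q\<^sub>j\<close> cancel.
\<close>

lemma virial_inequality:
  fixes q :: "'n::finite \<Rightarrow> real" and x :: "'n \<Rightarrow> real" and h :: "'n \<Rightarrow> 'n \<Rightarrow> real" and \<beta> :: real
  assumes sym: "\<And>j k. h j k = h k j"
  defines "n \<equiv> real CARD('n)"
    and "X \<equiv> \<Sum>k\<in>UNIV. x k * q k"
    and "G \<equiv> \<Sum>k\<in>UNIV. (q k)\<^sup>2"
    and "R \<equiv> \<Sum>k\<in>UNIV. (x k)\<^sup>2"
  shows "(\<Sum>j\<in>UNIV. - 4 * (2 * ((q j + (\<Sum>k\<in>UNIV. x k * h k j)) * q j + X * h j j)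
        - ((\<Sum>k\<in>UNIV. 2 * q k * h k j) * x j + G)
        + n * (q j * q j + \<beta> * h j j)
        + (2 * \<beta> * q j * R * x j + \<beta>\<^sup>2 * (2 * x j) * x j + \<beta>\<^sup>2 * R))
      - 8 * (\<beta>\<^sup>2 + x j * (2 * \<beta> * q j)))
    \<le> ((\<Sum>j\<in>UNIV. h j j) - 2 * X + (R - n) * \<beta>)\<^sup>2 - 8 * n * \<beta>\<^sup>2"
    (is "?lhs \<le> ?rhs")
proof -
  define D where "D = (\<Sum>j\<in>UNIV. h j j)"
  define Y where "Y = (\<Sum>j\<in>UNIV. (\<Sum>k\<in>UNIV. x k * h k j) * q j)"
  \<comment> \<open>The two bilinear expressions in \<open>x\<close>, \<open>h\<close> and \<open>q\<close> agree, as \<open>h\<close> is symmetric.\<close>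
  have Y': "(\<Sum>j\<in>UNIV. (\<Sum>k\<in>UNIV. 2 * q k * h k j) * x j) = 2 * Y"
  proof -
    have "(\<Sum>j\<in>UNIV. (\<Sum>k\<in>UNIV. 2 * q k * h k j) * x j) =
        (\<Sum>j\<in>UNIV. \<Sum>k\<in>UNIV. 2 * q k * h k j * x j)"
      by (simp add: sum_distrib_right)
    also have "\<dots> = (\<Sum>k\<in>UNIV. \<Sum>j\<in>UNIV. 2 * q k * h k j * x j)"
      by (rule sum.swap)
    also have "\<dots> = 2 * Y"
      unfolding Y_def sum_distrib_left sum_distrib_right
      by (intro sum.cong refl) (simp add: sym mult.commute mult.left_commute)
    finally show ?thesis .
  qed
  have "(\<Sum>j\<in>UNIV. - 4 * (2 * ((q j + (\<Sum>k\<in>UNIV. x k * h k j)) * q j + X * h j j)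
        - ((\<Sum>k\<in>UNIV. 2 * q k * h k j) * x j + G)
        + n * (q j * q j + \<beta> * h j j)
        + (2 * \<beta> * q j * R * x j + \<beta>\<^sup>2 * (2 * x j) * x j + \<beta>\<^sup>2 * R))
      - 8 * (\<beta>\<^sup>2 + x j * (2 * \<beta> * q j)))
    = (\<Sum>j\<in>UNIV. (- 8 - 4 * n) * (q j)\<^sup>2 - 8 * ((\<Sum>k\<in>UNIV. x k * h k j) * q j)
        + (- 8 * X - 4 * n * \<beta>) * h j j + 4 * ((\<Sum>k\<in>UNIV. 2 * q k * h k j) * x j)
        + (- 8 * \<beta> * R - 16 * \<beta>) * (x j * q j) - 8 * \<beta>\<^sup>2 * (x j)\<^sup>2
        + (4 * G - 4 * \<beta>\<^sup>2 * R - 8 * \<beta>\<^sup>2))"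
    by (intro sum.cong refl) (simp add: algebra_simps power2_eq_square)
  also have "\<dots> = (- 8 - 4 * n) * G - 8 * Y + (- 8 * X - 4 * n * \<beta>) * D + 4 * (2 * Y)
        + (- 8 * \<beta> * R - 16 * \<beta>) * X - 8 * \<beta>\<^sup>2 * R + n * (4 * G - 4 * \<beta>\<^sup>2 * R - 8 * \<beta>\<^sup>2)"
    unfolding sum.distrib sum_subtractf sum_distrib_left[symmetric] Y'
    by (simp add: Y_def D_def X_def G_def R_def n_def)
      (simp add: algebra_simps)
  also have "\<dots> = (D - 2 * X + (R - n) * \<beta>)\<^sup>2 - 8 * n * \<beta>\<^sup>2
      - (D + R * \<beta> + 2 * X + n * \<beta>)\<^sup>2 - 8 * (G + 2 * \<beta> * X + \<beta>\<^sup>2 * R)"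
    by algebra
  also have "G + 2 * \<beta> * X + \<beta>\<^sup>2 * R = (\<Sum>j\<in>UNIV. (q j + \<beta> * x j)\<^sup>2)"
    unfolding G_def X_def R_def sum_distrib_left sum.distrib[symmetric]
    by (intro sum.cong refl) (simp add: algebra_simps power2_eq_square)
  finally have identity: "?lhs = ?rhs - (D + R * \<beta> + 2 * X + n * \<beta>)\<^sup>2
      - 8 * (\<Sum>j\<in>UNIV. (q j + \<beta> * x j)\<^sup>2)"
    unfolding D_def .
  have "s \<le> r" if "s = r - a - 8 * b" "0 \<le> a" "0 \<le> b" for s r a b :: real
    using that by linarith
  from this[OF identity] show ?thesis by (simp add: sum_nonneg)
qed

lemma has_partial_component: "has_partial j (\<lambda>x. x $ i) (\<lambda>_. if i = j then 1 else 0)"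
  unfolding has_partial_def by (auto simp: axis_def intro!: derivative_eq_intros)

lemma has_partial_const: "has_partial j (\<lambda>_. c) (\<lambda>_. 0)"
  unfolding has_partial_def by auto

lemma has_partial_add:
  "has_partial j f f' \<Longrightarrow> has_partial j g g' \<Longrightarrow> has_partial j (\<lambda>x. f x + g x) (\<lambda>x. f' x + g' x)"
  unfolding has_partial_def by (auto intro: DERIV_add)

lemma has_partial_mult:
  "has_partial j f f' \<Longrightarrow> has_partial j g g' \<Longrightarrow>
    has_partial j (\<lambda>x. f x * g x) (\<lambda>x. f' x * g x + f x * g' x)"
  unfolding has_partial_def by (auto intro!: derivative_eq_intros)

lemma has_partial_sum:
  "(\<And>i. i \<in> I \<Longrightarrow> has_partial j (f i) (f' i)) \<Longrightarrow>
    has_partial j (\<lambda>x. \<Sum>i\<in>I. f i x) (\<lambda>x. \<Sum>i\<in>I. f' i x)"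
  unfolding has_partial_def by (auto intro!: DERIV_sum)

lemma has_partial_power2:
  "has_partial j f f' \<Longrightarrow> has_partial j (\<lambda>x. (f x)\<^sup>2) (\<lambda>x. 2 * f x * f' x)"
  unfolding has_partial_def by (auto intro!: derivative_eq_intros)

lemma norm_power2_eq_sum_components: "(norm x)\<^sup>2 = (\<Sum>k\<in>UNIV. (x $ k)\<^sup>2)" for x :: "real^'n::finite"
  by (simp add: power2_norm_eq_inner inner_vec_def) (simp add: power2_eq_square)

lemma has_partial_norm_power2: "has_partial j (\<lambda>x. (norm x)\<^sup>2) (\<lambda>x. 2 * x $ j)"
proof -
  have "has_partial j (\<lambda>x. (norm x)\<^sup>2) (\<lambda>x. \<Sum>k\<in>UNIV. 2 * x $ k * (if k = j then 1 else 0))"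
    unfolding norm_power2_eq_sum_components
    by (intro has_partial_sum has_partial_power2 has_partial_component)
  then show ?thesis by (simp add: if_distrib[of "\<lambda>c. _ * c"] cong: if_cong)
qed

text \<open>
  Integration of \<open>virial_inequality\<close>. The operator on the right is the Laplacian conjugated with
  the Gaussian: it maps \<open>\<beta>\<close> to \<open>w \<Delta>(\<beta> / w)\<close> for \<open>w = exp (|x|\<^sup>2 / 2)\<close>.
\<close>

lemma twisted_laplacian_lower_bound:
  fixes \<beta> :: "real^'n::finite \<Rightarrow> real" and q :: "'n \<Rightarrow> real^'n \<Rightarrow> real"
    and h :: "'n \<Rightarrow> 'n \<Rightarrow> real^'n \<Rightarrow> real"
  assumes \<beta>: "\<And>j. has_partial j \<beta> (q j)" and q: "\<And>j k. has_partial k (q j) (h j k)"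
    and cont: "continuous_on UNIV \<beta>" "\<And>j. continuous_on UNIV (q j)" "\<And>j k. continuous_on UNIV (h j k)"
    and zero: "\<And>x. r < norm x \<Longrightarrow> \<beta> x = 0"
  shows "8 * real CARD('n) * (LINT x|lborel. (\<beta> x)\<^sup>2) \<le> (LINT x|lborel.
    ((\<Sum>j\<in>UNIV. h j j x) - 2 * (\<Sum>j\<in>UNIV. x $ j * q j x)
      + ((norm x)\<^sup>2 - real CARD('n)) * \<beta> x)\<^sup>2)"
proof -
  let ?n = "real CARD('n)"
  define X where "X x = (\<Sum>k\<in>UNIV. x $ k * q k x)" for x
  define G where "G x = (\<Sum>k\<in>UNIV. (q k x)\<^sup>2)" for x
  define R where "R x = (\<Sum>k\<in>UNIV. (x $ k)\<^sup>2)" for x :: "real^'n"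
  define F where "F j x = - 4 * (2 * (X x * q j x) - G x * x $ j + ?n * (\<beta> x * q j x)
      + (\<beta> x)\<^sup>2 * R x * x $ j) - 8 * (x $ j * (\<beta> x)\<^sup>2)" for j x
  \<comment> \<open>The partial derivative of \<open>F j\<close> in direction \<open>j\<close>.\<close>
  define F' where "F' j x =
      - 4 * (2 * ((q j x + (\<Sum>k\<in>UNIV. x $ k * h k j x)) * q j x + X x * h j j x)
        - ((\<Sum>k\<in>UNIV. 2 * q k x * h k j x) * x $ j + G x)
        + ?n * (q j x * q j x + \<beta> x * h j j x)
        + (2 * \<beta> x * q j x * R x * x $ j + (\<beta> x)\<^sup>2 * (2 * x $ j) * x $ j + (\<beta> x)\<^sup>2 * R x))
      - 8 * ((\<beta> x)\<^sup>2 + x $ j * (2 * \<beta> x * q j x))" for j x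
  let ?T = "\<lambda>x. (\<Sum>j\<in>UNIV. h j j x) - 2 * X x + ((norm x)\<^sup>2 - ?n) * \<beta> x"
  have sym: "h j k = h k j" for j k
    using mixed_partials_eq[OF \<beta> \<beta> q q cont(3) cont(3)] by blast
  have norm_R: "(norm x)\<^sup>2 = R x" for x :: "real^'n"
    by (simp add: R_def norm_power2_eq_sum_components)
  have delta: "(\<Sum>k\<in>UNIV. (if k = j then 1 else 0) * a k + b k) = a j + (\<Sum>k\<in>UNIV. b k)"
    for j :: 'n and a b :: "'n \<Rightarrow> real"
    by (simp add: sum.distrib if_distrib[of "\<lambda>c. c * _"] cong: if_cong)
  have X': "has_partial j X (\<lambda>x. q j x + (\<Sum>k\<in>UNIV. x $ k * h k j x))" for j
  proof -
    have "has_partial j X (\<lambda>x. \<Sum>k\<in>UNIV. (if k = j then 1 else 0) * q k x + x $ k * h k j x)"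
      unfolding X_def by (intro has_partial_sum has_partial_mult has_partial_component q)
    then show ?thesis unfolding delta .
  qed
  have G': "has_partial j G (\<lambda>x. \<Sum>k\<in>UNIV. 2 * q k x * h k j x)" for j
    unfolding G_def by (intro has_partial_sum has_partial_power2 q)
  have R': "has_partial j R (\<lambda>x. 2 * x $ j)" for j
    using has_partial_norm_power2[of j] by (simp add: norm_R)
  have F: "has_partial j (F j) (F' j)" for j
    using \<beta>[of j] q[of j j] X'[of j] G'[of j] R'[of j] has_partial_component[of j j]
    unfolding has_partial_def F_def F'_def
    by (auto intro!: derivative_eq_intros simp: algebra_simps power2_eq_square)
  have contX: "continuous_on UNIV X" "continuous_on UNIV G" "continuous_on UNIV R"
    unfolding X_def G_def R_def by (intro continuous_intros cont)+
  have contF: "continuous_on UNIV (F j)" "continuous_on UNIV (F' j)" for j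
    unfolding F_def F'_def by (intro continuous_intros cont contX)+
  have qzero: "q j x = 0" if "r < norm x" for j x
    using has_partial_zero_outside_ball[OF \<beta> zero that] .
  have hzero: "h j k x = 0" if "r < norm x" for j k x
    using has_partial_zero_outside_ball[OF q qzero that] .
  have Fzero: "F j x = 0" "F' j x = 0" if "r < norm x" for j x
    using that by (simp_all add: F_def F'_def qzero hzero zero X_def G_def)
  have "(LINT x|lborel. (\<Sum>j\<in>UNIV. F' j x)) = (\<Sum>j\<in>UNIV. (LINT x|lborel. F' j x))"
    by (intro Bochner_Integration.integral_sum integrable_continuous_zero_outside_ball[OF contF(2) Fzero(2)])
  also have "\<dots> = 0"
    by (intro sum.neutral ballI integral_partial_eq_0[OF F contF Fzero(1)])
  finally have intF: "(LINT x|lborel. (\<Sum>j\<in>UNIV. F' j x)) = 0" .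
  have int\<beta>: "integrable lborel (\<lambda>x. 8 * ?n * (\<beta> x)\<^sup>2)"
    by (rule integrable_continuous_zero_outside_ball[where R = r])
      (auto intro!: continuous_intros cont simp: zero)
  have intT: "integrable lborel (\<lambda>x. (?T x)\<^sup>2)"
    by (rule integrable_continuous_zero_outside_ball[where R = r])
      (auto intro!: continuous_intros cont contX simp: zero qzero hzero X_def)
  have "(LINT x|lborel. (\<Sum>j\<in>UNIV. F' j x)) \<le> (LINT x|lborel. (?T x)\<^sup>2 - 8 * ?n * (\<beta> x)\<^sup>2)"
  proof (rule integral_mono)
    show "integrable lborel (\<lambda>x. \<Sum>j\<in>UNIV. F' j x)"
      by (intro Bochner_Integration.integrable_sum integrable_continuous_zero_outside_ball[OF contF(2) Fzero(2)])
    show "integrable lborel (\<lambda>x. (?T x)\<^sup>2 - 8 * ?n * (\<beta> x)\<^sup>2)"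
      by (intro Bochner_Integration.integrable_diff intT int\<beta>)
    show "(\<Sum>j\<in>UNIV. F' j x) \<le> (?T x)\<^sup>2 - 8 * ?n * (\<beta> x)\<^sup>2" for x
      unfolding F'_def norm_R unfolding X_def G_def R_def
      by (rule virial_inequality) (simp add: sym)
  qed
  also have "\<dots> = (LINT x|lborel. (?T x)\<^sup>2) - 8 * ?n * (LINT x|lborel. (\<beta> x)\<^sup>2)"
    using intT int\<beta> by simp
  finally show ?thesis
    unfolding intF X_def by simp
qed

section \<open>Test functions and the a priori estimate\<close>

lemma differentiable_imp_has_partial:
  assumes "\<psi> differentiable_on UNIV"
  shows "has_partial j \<psi> (partial_deriv j \<psi>)"
  unfolding has_partial_def
proof
  fix x
  obtain D where D: "(\<psi> has_derivative D) (at x)"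
    using assms by (auto simp: differentiable_on_def differentiable_def)
  have "((\<lambda>t. \<psi> (x + t *\<^sub>R axis j 1)) has_derivative (\<lambda>t. D (t *\<^sub>R axis j 1))) (at 0)"
    by (rule has_derivative_compose[where g = \<psi>]) (auto intro!: derivative_eq_intros D)
  moreover have "D (t *\<^sub>R axis j 1) = D (axis j 1) * t" for t
    using has_derivative_linear[OF D] by (simp add: linear_cmul mult.commute)
  ultimately have "((\<lambda>t. \<psi> (x + t *\<^sub>R axis j 1)) has_real_derivative D (axis j 1)) (at 0)"
    by (simp add: has_field_derivative_def)
  then show "((\<lambda>t. \<psi> (x + t *\<^sub>R axis j 1)) has_real_derivative partial_deriv j \<psi> x) (at 0)"
    using DERIV_imp_deriv by (fastforce simp: partial_deriv_def)
qed

lemma has_partial_imp_partial_deriv: "has_partial j f f' \<Longrightarrow> partial_deriv j f = f'"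
  unfolding has_partial_def partial_deriv_def by (auto intro!: ext DERIV_imp_deriv)

lemma partial_deriv_add_scaled:
  assumes "f differentiable_on UNIV" "g differentiable_on UNIV"
  shows "partial_deriv j (\<lambda>x. f x + c * g x) = (\<lambda>x. partial_deriv j f x + c * partial_deriv j g x)"
proof -
  have "has_partial j (\<lambda>x. f x + c * g x) (\<lambda>x. partial_deriv j f x + (0 * g x + c * partial_deriv j g x))"
    using assms
    by (intro has_partial_add has_partial_mult has_partial_const differentiable_imp_has_partial) simp_all
  from has_partial_imp_partial_deriv[OF this] show ?thesis by simp
qed

lemma test_function_differentiable:
  assumes "\<psi> \<in> test_functions S"
  shows "\<psi> differentiable_on UNIV"
proof -
  have "continuously_differentiable (Suc 0) \<psi>"
    using assms by (simp only: test_functions_def mem_Collect_eq)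
  then show ?thesis by simp
qed

lemma test_function_has_partial:
  "\<psi> \<in> test_functions S \<Longrightarrow> has_partial j \<psi> (partial_deriv j \<psi>)"
  by (intro differentiable_imp_has_partial test_function_differentiable)

lemma test_function_continuous:
  assumes "\<psi> \<in> test_functions S"
  shows "continuous_on UNIV \<psi>"
proof -
  have "continuously_differentiable 0 \<psi>" using assms by (simp only: test_functions_def mem_Collect_eq)
  then show ?thesis by simp
qed

lemma test_function_partial_deriv:
  assumes "\<psi> \<in> test_functions S"
  shows "partial_deriv j \<psi> \<in> test_functions S"
proof -
  let ?K = "closure {x. \<psi> x \<noteq> 0}" and ?L = "closure {x. partial_deriv j \<psi> x \<noteq> 0}"
  have K: "compact ?K" "?K \<subseteq> S" and smooth: "\<And>k. continuously_differentiable (Suc k) \<psi>"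
    using assms unfolding test_functions_def by blast+
  have "partial_deriv j \<psi> x = 0" if x: "x \<notin> ?K" for x
  proof -
    have "open (- ?K)" by (intro open_Compl closed_closure)
    then obtain e where "0 < e" and e: "ball x e \<subseteq> - ?K"
      using x by (meson ComplI openE)
    have "\<psi> (x + t *\<^sub>R axis j 1) = 0" if "\<bar>t\<bar> < e" for t
    proof -
      have "x + t *\<^sub>R axis j 1 \<in> ball x e" using that by (simp add: dist_norm)
      then have "x + t *\<^sub>R axis j 1 \<notin> ?K" using e by (meson ComplD subsetD)
      then show ?thesis using subsetD[OF closure_subset, of _ "{x. \<psi> x \<noteq> 0}"] by (metis mem_Collect_eq)
    qed
    then have "\<forall>\<^sub>F t in nhds 0. \<psi> (x + t *\<^sub>R axis j 1) = 0"
      unfolding eventually_nhds_metric using \<open>0 < e\<close> by (auto simp: dist_real_def)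
    then have "((\<lambda>t. \<psi> (x + t *\<^sub>R axis j 1)) has_real_derivative 0) (at 0)"
      by (subst DERIV_cong_ev[OF refl _ refl]) auto
    then show ?thesis unfolding partial_deriv_def by (rule DERIV_imp_deriv)
  qed
  then have "{x. partial_deriv j \<psi> x \<noteq> 0} \<subseteq> ?K" by blast
  then have sub: "?L \<subseteq> ?K" by (rule closure_minimal) (rule closed_closure)
  have "compact (?K \<inter> ?L)" by (intro compact_Int_closed K closed_closure)
  then have "compact ?L" by (simp only: Int_absorb1[OF sub])
  moreover have "continuously_differentiable k (partial_deriv j \<psi>)" for k
    using smooth[of k] by simp
  ultimately show ?thesis
    using K(2) sub unfolding test_functions_def by blast
qed

lemma continuously_differentiable_add_scaled:
  "continuously_differentiable k f \<Longrightarrow> continuously_differentiable k g \<Longrightarrow>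
    continuously_differentiable k (\<lambda>x. f x + c * g x)"
proof (induction k arbitrary: f g)
  case 0
  then show ?case by (auto intro!: continuous_intros)
next
  case (Suc k)
  have "partial_deriv j (\<lambda>x. f x + c * g x) = (\<lambda>x. partial_deriv j f x + c * partial_deriv j g x)" for j
    using Suc.prems by (intro partial_deriv_add_scaled) simp_all
  moreover have "(\<lambda>x. f x + c * g x) differentiable_on UNIV"
    using Suc.prems by (intro differentiable_on_add differentiable_on_mult differentiable_on_const) auto
  moreover have "continuously_differentiable k (\<lambda>x. partial_deriv j f x + c * partial_deriv j g x)" for j
    using Suc.prems by (intro Suc.IH) auto
  ultimately show ?case by simp
qed

lemma test_functions_add_scaled:
  assumes "\<psi> \<in> test_functions S" "\<eta> \<in> test_functions S"
  shows "(\<lambda>x. \<psi> x + c * \<eta> x) \<in> test_functions S"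
proof -
  let ?K = "closure {x. \<psi> x \<noteq> 0}" and ?L = "closure {x. \<eta> x \<noteq> 0}"
  let ?P = "closure {x. \<psi> x + c * \<eta> x \<noteq> 0}"
  have KL: "compact (?K \<union> ?L)" "?K \<union> ?L \<subseteq> S"
    using assms by (auto simp: test_functions_def)
  have "?P \<subseteq> closure ({x. \<psi> x \<noteq> 0} \<union> {x. \<eta> x \<noteq> 0})"
    by (intro closure_mono) auto
  then have P: "?P \<subseteq> ?K \<union> ?L" by (simp only: closure_Un)
  have "compact ((?K \<union> ?L) \<inter> ?P)" by (intro compact_Int_closed KL closed_closure)
  then have "compact ?P" by (simp only: Int_absorb1[OF P])
  moreover have "continuously_differentiable k (\<lambda>x. \<psi> x + c * \<eta> x)" for k
    using assms by (intro continuously_differentiable_add_scaled) (simp_all add: test_functions_def)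
  ultimately show ?thesis
    using P KL(2) unfolding test_functions_def by blast
qed

lemma zero_test_function:
  fixes S :: "(real^'n::finite) set"
  shows "(\<lambda>_. 0) \<in> test_functions S"
proof -
  have "partial_deriv j (\<lambda>_. 0) = (\<lambda>_. 0)" for j :: 'n
    by (rule has_partial_imp_partial_deriv[OF has_partial_const])
  note zero = this
  have "continuously_differentiable k (\<lambda>_ :: real^'n. 0)" for k
    by (induction k) (simp_all add: zero)
  then show ?thesis by (simp add: test_functions_def)
qed

lemma test_function_zero_outside_ball:
  assumes "\<psi> \<in> test_functions S"
  obtains r where "\<And>x. r < norm x \<Longrightarrow> \<psi> x = 0"
proof -
  have "bounded (closure {x. \<psi> x \<noteq> 0})"
    using assms by (auto simp: test_functions_def intro: compact_imp_bounded)
  then have "bounded {x. \<psi> x \<noteq> 0}" by (rule bounded_subset) (rule closure_subset)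
  then show ?thesis using that unfolding bounded_iff by (metis mem_Collect_eq not_less)
qed

lemma test_function_zero_outside:
  "\<psi> \<in> test_functions S \<Longrightarrow> x \<notin> S \<Longrightarrow> \<psi> x = 0"
  using closure_subset[of "{x. \<psi> x \<noteq> 0}"] by (auto simp: test_functions_def)

lemma laplacian_zero_outside:
  "\<psi> \<in> test_functions S \<Longrightarrow> x \<notin> S \<Longrightarrow> laplacian \<psi> x = 0"
  unfolding laplacian_def
  by (intro sum.neutral ballI test_function_zero_outside[of _ S] test_function_partial_deriv)

lemma laplacian_zero_outside_ball:
  assumes "\<psi> \<in> test_functions S" "\<And>x. r < norm x \<Longrightarrow> \<psi> x = 0" "r < norm x"
  shows "laplacian \<psi> x = 0"
proof -
  have "partial_deriv j \<psi> x = 0" if "r < norm x" for x j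
    by (rule has_partial_zero_outside_ball[OF test_function_has_partial[OF assms(1)] assms(2) that])
  then have "partial_deriv j (partial_deriv j \<psi>) x = 0" for j
    by (rule has_partial_zero_outside_ball[OF
          test_function_has_partial[OF test_function_partial_deriv[OF assms(1)]] _ assms(3)])
  then show ?thesis by (simp add: laplacian_def)
qed

lemma laplacian_continuous:
  "\<psi> \<in> test_functions S \<Longrightarrow> continuous_on UNIV (laplacian \<psi>)"
  unfolding laplacian_def
  by (intro continuous_on_sum test_function_continuous[of _ S] test_function_partial_deriv)

lemma laplacian_add_scaled:
  assumes "\<psi> \<in> test_functions S" "\<eta> \<in> test_functions S"
  shows "laplacian (\<lambda>x. \<psi> x + c * \<eta> x) x = laplacian \<psi> x + c * laplacian \<eta> x"
proof -
  note diff = assms[THEN test_function_differentiable]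
    assms[THEN test_function_partial_deriv, THEN test_function_differentiable]
  show ?thesis
    unfolding laplacian_def
    by (simp add: partial_deriv_add_scaled[OF diff(1,2)] partial_deriv_add_scaled[OF diff(3,4)]
        sum.distrib sum_distrib_left)
qed

lemma has_partial_gaussian:
  "has_partial j (\<lambda>x. exp ((norm x)\<^sup>2 / 2)) (\<lambda>x. exp ((norm x)\<^sup>2 / 2) * x $ j)"
  unfolding has_partial_def
proof
  fix x :: "real^'a"
  have "((\<lambda>t. (norm (x + t *\<^sub>R axis j 1))\<^sup>2) has_real_derivative 2 * x $ j) (at 0)"
    using has_partial_norm_power2[of j] by (simp add: has_partial_def)
  from DERIV_fun_exp[OF DERIV_cdivide[OF this, of 2]]
  show "((\<lambda>t. exp ((norm (x + t *\<^sub>R axis j 1))\<^sup>2 / 2)) has_real_derivative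
      exp ((norm x)\<^sup>2 / 2) * x $ j) (at 0)"
    by simp
qed

lemma exp_half_power2: "(exp (a / 2))\<^sup>2 = exp (a::real)"
  by (simp add: power2_eq_square exp_add[symmetric])

text \<open>
  The a priori estimate. Here \<open>q\<close> and \<open>h\<close> are the gradient and the Hessian of \<open>\<beta> = w \<psi>\<close>, for which the
  conjugated Laplacian is \<open>w \<Delta>\<psi>\<close>.
\<close>

lemma weighted_laplacian_lower_bound:
  fixes \<psi> :: "real^'n::finite \<Rightarrow> real"
  assumes \<psi>: "\<psi> \<in> test_functions S"
  shows "8 * real CARD('n) * (LINT x|lborel. (exp ((norm x)\<^sup>2 / 2) * \<psi> x)\<^sup>2)
    \<le> (LINT x|lborel. (exp ((norm x)\<^sup>2 / 2) * laplacian \<psi> x)\<^sup>2)"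
proof -
  define w where "w x = exp ((norm x)\<^sup>2 / 2)" for x :: "real^'n"
  define p where "p j = partial_deriv j \<psi>" for j
  define P where "P j k = partial_deriv k (p j)" for j k
  define q where "q j x = w x * x $ j * \<psi> x + w x * p j x" for j x
  define h where "h j k x = ((w x * x $ k) * x $ j + w x * (if j = k then 1 else 0)) * \<psi> x
    + (w x * x $ j) * p k x + ((w x * x $ k) * p j x + w x * P j k x)" for j k x
  have p: "has_partial j \<psi> (p j)" and P: "has_partial k (p j) (P j k)" for j k
    unfolding P_def p_def
    by (intro test_function_has_partial[of _ S] test_function_partial_deriv \<psi>)+
  have w: "has_partial k w (\<lambda>x. w x * x $ k)" for k
    unfolding w_def by (rule has_partial_gaussian)
  obtain r where r: "\<And>x. r < norm x \<Longrightarrow> \<psi> x = 0"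
    using test_function_zero_outside_ball[OF \<psi>] by blast
  have cont_w: "continuous_on UNIV w"
    unfolding w_def by (intro continuous_intros) simp
  have cont: "continuous_on UNIV \<psi>" "continuous_on UNIV (p j)" "continuous_on UNIV (P j k)" for j k
    unfolding P_def p_def
    by (intro test_function_continuous[of _ S] test_function_partial_deriv \<psi>)+
  have twisted: "(\<Sum>j\<in>UNIV. h j j x) - 2 * (\<Sum>j\<in>UNIV. x $ j * q j x)
      + ((norm x)\<^sup>2 - real CARD('n)) * (w x * \<psi> x) = w x * laplacian \<psi> x" for x
  proof -
    have "(\<Sum>j\<in>UNIV. h j j x) - 2 * (\<Sum>j\<in>UNIV. x $ j * q j x) =
        (\<Sum>j\<in>UNIV. w x * P j j x + w x * \<psi> x - w x * \<psi> x * (x $ j)\<^sup>2)"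
      unfolding sum_distrib_left sum_subtractf[symmetric] h_def q_def
      by (intro sum.cong refl) (simp add: algebra_simps power2_eq_square)
    also have "\<dots> = w x * laplacian \<psi> x - ((norm x)\<^sup>2 - real CARD('n)) * (w x * \<psi> x)"
      unfolding sum_subtractf sum.distrib sum_distrib_left[symmetric] norm_power2_eq_sum_components[symmetric]
      by (simp add: laplacian_def P_def p_def algebra_simps)
    finally show ?thesis by simp
  qed
  have "8 * real CARD('n) * (LINT x|lborel. (w x * \<psi> x)\<^sup>2) \<le> (LINT x|lborel.
    ((\<Sum>j\<in>UNIV. h j j x) - 2 * (\<Sum>j\<in>UNIV. x $ j * q j x)
      + ((norm x)\<^sup>2 - real CARD('n)) * (w x * \<psi> x))\<^sup>2)"
  proof (rule twisted_laplacian_lower_bound[where \<beta> = "\<lambda>x. w x * \<psi> x" and q = q and h = h and r = r])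
    show "has_partial j (\<lambda>x. w x * \<psi> x) (q j)" for j
      unfolding q_def by (intro has_partial_mult w p)
    show "has_partial k (q j) (h j k)" for j k
      unfolding q_def h_def
      by (intro has_partial_add has_partial_mult w p P has_partial_component)
    show "\<And>x. r < norm x \<Longrightarrow> w x * \<psi> x = 0"
      using r by simp
    show "continuous_on UNIV (\<lambda>x. w x * \<psi> x)"
      by (intro continuous_intros cont cont_w)
    show "continuous_on UNIV (q j)" for j
      unfolding q_def by (intro continuous_intros cont cont_w)
    show "continuous_on UNIV (h j k)" for j k
      unfolding h_def by (intro continuous_intros cont cont_w)
  qed
  then show ?thesis unfolding twisted unfolding w_def .
qed

section \<open>Weak solutions of the Poisson equation\<close>

text \<open>
  The weights \<open>exp \<phi>\<close> for \<open>g\<close> and \<open>exp (- \<phi>)\<close> for \<open>u\<close> are dual to each other, so the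
  product is dominated by the sum of the two weighted squares.
\<close>

lemma weighted_L2_integrable:
  fixes u :: "'a::euclidean_space \<Rightarrow> 'b::euclidean_space"
  assumes u: "u \<in> weighted_L2 \<phi> S" and g: "g \<in> borel_measurable (lebesgue_on S)"
    and int: "integrable (lebesgue_on S) (\<lambda>x. (g x)\<^sup>2 * exp (\<phi> x))"
  shows "integrable (lebesgue_on S) (\<lambda>x. g x *\<^sub>R u x)"
proof (rule Bochner_Integration.integrable_bound)
  show "integrable (lebesgue_on S) (\<lambda>x. (g x)\<^sup>2 * exp (\<phi> x) + (norm (u x))\<^sup>2 * exp (- \<phi> x))"
    using u int by (simp add: weighted_L2_def)
  show "(\<lambda>x. g x *\<^sub>R u x) \<in> borel_measurable (lebesgue_on S)"
    using u g by (auto simp: weighted_L2_def intro: borel_measurable_scaleR)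
  have "norm (g x *\<^sub>R u x) \<le> (g x)\<^sup>2 * exp (\<phi> x) + (norm (u x))\<^sup>2 * exp (- \<phi> x)" for x
  proof -
    define a where "a = \<bar>g x\<bar> * exp (\<phi> x / 2)"
    define b where "b = norm (u x) * exp (- \<phi> x / 2)"
    have "norm (g x *\<^sub>R u x) = a * b * exp (0)"
      unfolding a_def b_def by (simp add: exp_minus field_simps)
    moreover have "2 * (a * b) \<le> a\<^sup>2 + b\<^sup>2"
      using sum_squares_bound[of a b] by (simp add: mult.assoc)
    moreover have "0 \<le> a * b" by (simp add: a_def b_def)
    moreover have "a\<^sup>2 = (g x)\<^sup>2 * exp (\<phi> x)" "b\<^sup>2 = (norm (u x))\<^sup>2 * exp (- \<phi> x)"
      unfolding a_def b_def power_mult_distrib exp_half_power2 by simp_all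
    ultimately show ?thesis by simp
  qed
  then show "AE x in lebesgue_on S. norm (g x *\<^sub>R u x)
      \<le> norm ((g x)\<^sup>2 * exp (\<phi> x) + (norm (u x))\<^sup>2 * exp (- \<phi> x))"
    by (intro AE_I2) (simp add: abs_of_nonneg)
qed

lemma integrable_lebesgue_on_subset:
  fixes f :: "'a::euclidean_space \<Rightarrow> 'b::{banach, second_countable_topology}"
  assumes "integrable (lebesgue_on S) f" "S \<in> sets lebesgue" "K \<in> sets lebesgue" "K \<subseteq> S"
  shows "integrable (lebesgue_on K) f"
proof -
  have "set_integrable lebesgue S f"
    unfolding set_integrable_def using assms(1) by (rule integrable_restrict_space[THEN iffD1, rotated]) (use assms(2) in simp)
  then have "set_integrable lebesgue K f"
    by (rule set_integrable_subset[OF _ assms(3,4)])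
  then show ?thesis
    unfolding set_integrable_def by (rule integrable_restrict_space[THEN iffD2, rotated]) (use assms(3) in simp)
qed

lemma integrable_lebesgue_on_compact:
  fixes f :: "'a::euclidean_space \<Rightarrow> real"
  assumes "compact K" "continuous_on UNIV f"
  shows "integrable (lebesgue_on K) f"
proof -
  have K: "K \<inter> space lebesgue \<in> sets lebesgue"
    using borel_compact[OF assms(1)] by simp
  have "f \<in> borel_measurable borel"
    using assms(2) by (rule borel_measurable_continuous_onI)
  then have meas: "(\<lambda>x. indicator K x *\<^sub>R f x) \<in> borel_measurable lborel"
    using borel_compact[OF assms(1)] by measurable
  have "continuous_on K f"
    using assms(2) by (rule continuous_on_subset) simp
  with assms(1) have "integrable lborel (\<lambda>x. indicator K x *\<^sub>R f x)"
    by (rule borel_integrable_compact)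
  then have "integrable lebesgue (\<lambda>x. indicator K x *\<^sub>R f x)"
    by (rule integrable_completion[OF meas, THEN iffD2])
  then show ?thesis
    by (rule integrable_restrict_space[OF K, THEN iffD2])
qed

lemma weighted_L2_locally_integrable:
  fixes u :: "'a::euclidean_space \<Rightarrow> 'b::euclidean_space"
  assumes u: "u \<in> weighted_L2 \<phi> S" and S: "open S" and \<phi>: "continuous_on UNIV \<phi>"
  shows "locally_integrable S u"
  unfolding locally_integrable_def
proof (intro allI impI)
  fix K assume "compact K \<and> K \<subseteq> S"
  then have K: "compact K" "K \<subseteq> S" by simp_all
  have sets: "S \<in> sets lebesgue" "K \<in> sets lebesgue"
    using borel_open[OF S] borel_compact[OF K(1)] by simp_all
  have uS: "u \<in> borel_measurable (lebesgue_on S)"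
    "integrable (lebesgue_on S) (\<lambda>x. (norm (u x))\<^sup>2 * exp (- \<phi> x))"
    using u by (simp_all add: weighted_L2_def)
  have uK: "u \<in> weighted_L2 \<phi> K"
    unfolding weighted_L2_def
    using measurable_restrict_mono[OF uS(1) K(2)] integrable_lebesgue_on_subset[OF uS(2) sets K(2)]
    by simp
  have "continuous_on UNIV (\<lambda>x. 1\<^sup>2 * exp (\<phi> x))"
    by (intro continuous_intros \<phi>)
  then have "integrable (lebesgue_on K) (\<lambda>x. 1\<^sup>2 * exp (\<phi> x))"
    by (rule integrable_lebesgue_on_compact[OF K(1)])
  then have "integrable (lebesgue_on K) (\<lambda>x. 1 *\<^sub>R u x)"
    by (rule weighted_L2_integrable[OF uK borel_measurable_const])
  then show "integrable (lebesgue_on K) u" by simp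
qed

lemma lebesgue_on_eq_lborel:
  fixes g :: "real^'n::finite \<Rightarrow> real"
  assumes S: "open S" and g: "continuous_on UNIV g"
    and zero: "\<And>x. x \<notin> S \<Longrightarrow> g x = 0" "\<And>x. r < norm x \<Longrightarrow> g x = 0"
  shows "integrable (lebesgue_on S) g" "(LINT x|lebesgue_on S. g x) = (LINT x|lborel. g x)"
proof -
  have meas: "g \<in> borel_measurable lborel"
    using borel_measurable_continuous_onI[OF g] by simp
  have S': "S \<inter> space lebesgue \<in> sets lebesgue" using borel_open[OF S] by simp
  have eq: "(\<lambda>x. indicator S x *\<^sub>R g x) = g"
    using zero(1) by (fastforce simp: indicator_def)
  have "integrable lborel g"
    using g zero(2) by (rule integrable_continuous_zero_outside_ball)
  then have "integrable lebesgue g" by (rule integrable_completion[OF meas, THEN iffD2])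
  then show "integrable (lebesgue_on S) g"
    by (simp only: integrable_restrict_space[OF S'] eq)
  show "(LINT x|lebesgue_on S. g x) = (LINT x|lborel. g x)"
    by (simp only: integral_restrict_space[OF S'] eq integral_completion[OF meas])
qed

text \<open>
  The weight is absorbed into the functions, so that all norms are those of unweighted \<open>L\<^sup>2\<close> on \<open>S\<close>:
  with \<open>w = exp (|x|\<^sup>2 / 2)\<close>, the functional sends \<open>w \<Delta>\<psi>\<close> to \<open>\<integral>\<psi> f = \<integral>(w \<psi>) (f / w)\<close>. If \<open>v\<close>
  represents it, then \<open>u = v w\<close> is the solution.
\<close>

lemma scalar_Poisson_solvable:
  fixes S :: "(real^'n::finite) set" and f :: "real^'n \<Rightarrow> real"
  defines "\<phi> \<equiv> \<lambda>x :: real^'n. (norm x)\<^sup>2"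
  assumes S: "open S" and f: "f \<in> weighted_L2 \<phi> S"
  obtains u where "u \<in> weighted_L2 \<phi> S"
    "\<And>\<psi>. \<psi> \<in> test_functions S \<Longrightarrow>
      (LINT x|lebesgue_on S. laplacian \<psi> x * u x) = (LINT x|lebesgue_on S. \<psi> x * f x)"
    "weighted_norm_sq \<phi> S u \<le> weighted_norm_sq \<phi> S f / (8 * real CARD('n))"
proof -
  let ?M = "lebesgue_on S" and ?n = "real CARD('n)"
  define w where "w x = exp ((norm x)\<^sup>2 / 2)" for x :: "real^'n"
  define F where "F = (\<lambda>x. f x / w x)"
  define T where "T = (\<lambda>\<psi>. (\<lambda>x. w x * laplacian \<psi> x, LINT x|?M. \<psi> x * f x)) ` test_functions S"
  define C where "C = weighted_norm_sq \<phi> S f / (8 * ?n)"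
  have w_pos: "0 < w x" and w_sq: "(w x)\<^sup>2 = exp (\<phi> x)" for x
    by (simp_all add: w_def \<phi>_def exp_half_power2)
  have n: "0 < ?n" by simp
  have cont_w: "continuous_on UNIV w"
    unfolding w_def by (intro continuous_intros) simp
  have S': "S \<in> sets lebesgue" using borel_open[OF S] by simp
  have meas: "g \<in> borel_measurable ?M" if "continuous_on UNIV g" for g :: "real^'n \<Rightarrow> real"
    using continuous_imp_measurable_on_sets_lebesgue[OF continuous_on_subset[OF that] S'] by simp
  note w_meas = meas[OF cont_w]
  have sq_div: "(a / w x)\<^sup>2 = a\<^sup>2 * exp (- \<phi> x)" for a x
    by (simp add: power_divide w_sq exp_minus field_simps)
  have F: "square_integrable ?M F" "(LINT x|?M. (F x)\<^sup>2) = weighted_norm_sq \<phi> S f"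
    using f w_meas by (auto simp: F_def sq_div square_integrable_def weighted_L2_def weighted_norm_sq_def
        intro: borel_measurable_divide)
  have weighted: "square_integrable ?M (\<lambda>x. w x * g x)"
    "(LINT x|?M. (w x * g x)\<^sup>2) = (LINT x|lborel. (w x * g x)\<^sup>2)"
    if "continuous_on UNIV g" "\<And>x. x \<notin> S \<Longrightarrow> g x = 0" "\<And>x. r < norm x \<Longrightarrow> g x = 0" for g r
  proof -
    have cont: "continuous_on UNIV (\<lambda>x. w x * g x)" by (intro continuous_intros cont_w that(1))
    then have "(\<lambda>x. w x * g x) \<in> borel_measurable ?M" by (rule meas)
    moreover have sq: "continuous_on UNIV (\<lambda>x. (w x * g x)\<^sup>2)" by (intro continuous_intros cont)
    ultimately show "square_integrable ?M (\<lambda>x. w x * g x)"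
      using lebesgue_on_eq_lborel(1)[OF S sq, of r] that by (simp add: square_integrable_def)
    show "(LINT x|?M. (w x * g x)\<^sup>2) = (LINT x|lborel. (w x * g x)\<^sup>2)"
      using lebesgue_on_eq_lborel(2)[OF S sq, of r] that by simp
  qed
  have test: "square_integrable ?M (\<lambda>x. w x * \<psi> x)" "square_integrable ?M (\<lambda>x. w x * laplacian \<psi> x)"
    "8 * ?n * (LINT x|?M. (w x * \<psi> x)\<^sup>2) \<le> (LINT x|?M. (w x * laplacian \<psi> x)\<^sup>2)"
    if \<psi>: "\<psi> \<in> test_functions S" for \<psi>
  proof -
    obtain r where r: "\<And>x. r < norm x \<Longrightarrow> \<psi> x = 0"
      using test_function_zero_outside_ball[OF \<psi>] by blast
    note 1 = weighted[OF test_function_continuous[OF \<psi>] test_function_zero_outside[OF \<psi>] r]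
    note 2 = weighted[OF laplacian_continuous[OF \<psi>] laplacian_zero_outside[OF \<psi>]
        laplacian_zero_outside_ball[OF \<psi> r]]
    show "square_integrable ?M (\<lambda>x. w x * \<psi> x)" by (rule 1(1))
    show "square_integrable ?M (\<lambda>x. w x * laplacian \<psi> x)" by (rule 2(1))
    show "8 * ?n * (LINT x|?M. (w x * \<psi> x)\<^sup>2) \<le> (LINT x|?M. (w x * laplacian \<psi> x)\<^sup>2)"
    proof -
      have "(LINT x|?M. (w x * \<psi> x)\<^sup>2) = (LINT x|lborel. (w x * \<psi> x)\<^sup>2)" by (rule 1(2))
      moreover have "(LINT x|?M. (w x * laplacian \<psi> x)\<^sup>2) = (LINT x|lborel. (w x * laplacian \<psi> x)\<^sup>2)"
        by (rule 2(2))
      ultimately show ?thesis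
        unfolding w_def by (simp only: weighted_laplacian_lower_bound[OF \<psi>])
    qed
  qed
  have pairing: "\<psi> x * f x = (w x * \<psi> x) * F x" for \<psi> x
    using w_pos[of x] by (simp add: F_def)
  have int_pairing: "integrable ?M (\<lambda>x. \<psi> x * f x)" if "\<psi> \<in> test_functions S" for \<psi>
    unfolding pairing by (intro square_integrable_mult test(1) that F(1))
  obtain v where v: "square_integrable ?M v" "\<And>g l. (g, l) \<in> T \<Longrightarrow> (LINT x|?M. v x * g x) = l"
    "(LINT x|?M. (v x)\<^sup>2) \<le> C"
  proof (rule L2_Riesz_representation[of T ?M C])
    show "T \<noteq> {}" using zero_test_function by (auto simp: T_def)
    show "square_integrable ?M g" if "(g, l) \<in> T" for g l
      using that test(2) by (auto simp: T_def)
    show "(\<lambda>x. g x + c * h x, l + c * m) \<in> T" if "(g, l) \<in> T" "(h, m) \<in> T" for g l h m c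
    proof -
      obtain \<psi> \<eta> where \<psi>: "\<psi> \<in> test_functions S" "g = (\<lambda>x. w x * laplacian \<psi> x)" "l = (LINT x|?M. \<psi> x * f x)"
        and \<eta>: "\<eta> \<in> test_functions S" "h = (\<lambda>x. w x * laplacian \<eta> x)" "m = (LINT x|?M. \<eta> x * f x)"
        using \<open>(g, l) \<in> T\<close> \<open>(h, m) \<in> T\<close> by (auto simp: T_def)
      have "l + c * m = (LINT x|?M. \<psi> x * f x + c * (\<eta> x * f x))"
        unfolding \<psi>(3) \<eta>(3) using int_pairing[OF \<psi>(1)] int_pairing[OF \<eta>(1)] by simp
      also have "\<dots> = (LINT x|?M. (\<psi> x + c * \<eta> x) * f x)" by (simp add: algebra_simps)
      finally have "l + c * m = (LINT x|?M. (\<psi> x + c * \<eta> x) * f x)" .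
      moreover have "(\<lambda>x. g x + c * h x) = (\<lambda>x. w x * laplacian (\<lambda>x. \<psi> x + c * \<eta> x) x)"
        by (simp add: \<psi>(2) \<eta>(2) laplacian_add_scaled[OF \<psi>(1) \<eta>(1)] algebra_simps)
      ultimately show ?thesis
        unfolding T_def using test_functions_add_scaled[OF \<psi>(1) \<eta>(1)] by (intro image_eqI) auto
    qed
    show "l\<^sup>2 \<le> C * (LINT x|?M. (g x)\<^sup>2)" if "(g, l) \<in> T" for g l
    proof -
      obtain \<psi> where \<psi>: "\<psi> \<in> test_functions S" "g = (\<lambda>x. w x * laplacian \<psi> x)" "l = (LINT x|?M. \<psi> x * f x)"
        using \<open>(g, l) \<in> T\<close> by (auto simp: T_def)
      have "l\<^sup>2 \<le> (LINT x|?M. (w x * \<psi> x)\<^sup>2) * weighted_norm_sq \<phi> S f"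
        unfolding \<psi>(3) pairing F(2)[symmetric] by (intro integral_Cauchy_Schwarz test(1) \<psi>(1) F(1))
      also have "\<dots> \<le> ((LINT x|?M. (w x * laplacian \<psi> x)\<^sup>2) / (8 * ?n)) * weighted_norm_sq \<phi> S f"
        using test(3)[OF \<psi>(1)] n
        by (intro mult_right_mono) (simp_all add: F(2)[symmetric] pos_le_divide_eq mult.commute)
      finally show ?thesis by (simp add: C_def \<psi>(2) mult.commute)
    qed
    show "0 \<le> C" by (simp add: C_def F(2)[symmetric])
  qed blast
  have v_sq: "(v x * w x)\<^sup>2 * exp (- \<phi> x) = (v x)\<^sup>2" for x
    by (simp add: power_mult_distrib w_sq mult.assoc exp_add[symmetric])
  show ?thesis
  proof
    show "(\<lambda>x. v x * w x) \<in> weighted_L2 \<phi> S"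
      using v(1) w_meas by (auto simp: weighted_L2_def square_integrable_def v_sq intro: borel_measurable_times)
    show "weighted_norm_sq \<phi> S (\<lambda>x. v x * w x) \<le> weighted_norm_sq \<phi> S f / (8 * ?n)"
      using v(3) by (simp add: weighted_norm_sq_def v_sq C_def)
    show "(LINT x|?M. laplacian \<psi> x * (v x * w x)) = (LINT x|?M. \<psi> x * f x)" if "\<psi> \<in> test_functions S" for \<psi>
    proof -
      have "(\<lambda>x. w x * laplacian \<psi> x, LINT x|?M. \<psi> x * f x) \<in> T"
        unfolding T_def using that by (rule imageI)
      from v(2)[OF this] show ?thesis by (simp only: ac_simps)
    qed
  qed
qed

lemma norm_power2_eq_sum_Basis: "(norm x)\<^sup>2 = (\<Sum>b\<in>Basis. (norm (x \<bullet> b))\<^sup>2)" for x :: "'b::euclidean_space"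
  using euclidean_inner[of x x] by (simp add: power2_norm_eq_inner) (simp add: power2_eq_square)

lemma weighted_L2_component:
  fixes f :: "'a::euclidean_space \<Rightarrow> 'b::euclidean_space"
  assumes "f \<in> weighted_L2 \<phi> S" and b: "b \<in> Basis" and \<phi>: "(\<lambda>x. exp (- \<phi> x)) \<in> borel_measurable (lebesgue_on S)"
  shows "(\<lambda>x. f x \<bullet> b) \<in> weighted_L2 \<phi> S"
proof -
  have f: "f \<in> borel_measurable (lebesgue_on S)"
    "integrable (lebesgue_on S) (\<lambda>x. (norm (f x))\<^sup>2 * exp (- \<phi> x))"
    using assms by (auto simp: weighted_L2_def)
  have meas: "(\<lambda>x. f x \<bullet> b) \<in> borel_measurable (lebesgue_on S)"
    using f(1) by (intro borel_measurable_inner borel_measurable_const)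
  have "integrable (lebesgue_on S) (\<lambda>x. (norm (f x \<bullet> b))\<^sup>2 * exp (- \<phi> x))"
  proof (rule Bochner_Integration.integrable_bound[OF f(2)])
    show "(\<lambda>x. (norm (f x \<bullet> b))\<^sup>2 * exp (- \<phi> x)) \<in> borel_measurable (lebesgue_on S)"
      using meas \<phi> by measurable
    have "(norm (f x \<bullet> b))\<^sup>2 \<le> (norm (f x))\<^sup>2" for x
      using Basis_le_norm[OF b, of "f x"] by (intro power_mono) auto
    then show "AE x in lebesgue_on S. norm ((norm (f x \<bullet> b))\<^sup>2 * exp (- \<phi> x))
        \<le> norm ((norm (f x))\<^sup>2 * exp (- \<phi> x))"
      by (intro AE_I2) (simp add: abs_mult mult_right_mono)
  qed
  then show ?thesis using meas by (simp add: weighted_L2_def)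
qed

lemma weighted_norm_sq_components:
  fixes g :: "'a::euclidean_space \<Rightarrow> 'b::euclidean_space"
  assumes "\<And>b. b \<in> Basis \<Longrightarrow> (\<lambda>x. g x \<bullet> b) \<in> weighted_L2 \<phi> S"
  shows "integrable (lebesgue_on S) (\<lambda>x. (norm (g x))\<^sup>2 * exp (- \<phi> x))"
    and "weighted_norm_sq \<phi> S g = (\<Sum>b\<in>Basis. weighted_norm_sq \<phi> S (\<lambda>x. g x \<bullet> b))"
proof -
  have int: "integrable (lebesgue_on S) (\<lambda>x. (norm (g x \<bullet> b))\<^sup>2 * exp (- \<phi> x))" if "b \<in> Basis" for b
    using assms[OF that] by (simp add: weighted_L2_def)
  show "integrable (lebesgue_on S) (\<lambda>x. (norm (g x))\<^sup>2 * exp (- \<phi> x))"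
    unfolding norm_power2_eq_sum_Basis[of "g _"] sum_distrib_right
    by (intro Bochner_Integration.integrable_sum int)
  show "weighted_norm_sq \<phi> S g = (\<Sum>b\<in>Basis. weighted_norm_sq \<phi> S (\<lambda>x. g x \<bullet> b))"
    unfolding weighted_norm_sq_def norm_power2_eq_sum_Basis[of "g _"] sum_distrib_right
    by (intro Bochner_Integration.integral_sum int)
qed

text \<open>
  Solving coordinate by coordinate preserves the constant, as the squared norms add up. The last
  conclusion, that coordinates absent from \<open>f\<close> stay absent from \<open>u\<close>, is what keeps the solution
  inside a coordinate subspace such as the reals within the Clifford algebra.
\<close>

lemma Poisson_solvable:
  fixes S :: "(real^'n::finite) set" and f :: "real^'n \<Rightarrow> 'b::euclidean_space"
  defines "\<phi> \<equiv> \<lambda>x :: real^'n. (norm x)\<^sup>2"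
  assumes S: "open S" and f: "f \<in> weighted_L2 \<phi> S"
  obtains u where "u \<in> weighted_L2 \<phi> S" "distributional_laplacian S u f"
    "weighted_norm_sq \<phi> S u \<le> weighted_norm_sq \<phi> S f / (8 * real CARD('n))"
    "\<And>b x. b \<in> Basis \<Longrightarrow> \<forall>x\<in>S. f x \<bullet> b = 0 \<Longrightarrow> u x \<bullet> b = 0"
proof -
  let ?M = "lebesgue_on S" and ?n = "real CARD('n)"
  have S': "S \<in> sets lebesgue" using borel_open[OF S] by simp
  have cont_\<phi>: "continuous_on UNIV \<phi>" unfolding \<phi>_def by (intro continuous_intros)
  have meas: "g \<in> borel_measurable ?M" if "continuous_on UNIV g" for g :: "real^'n \<Rightarrow> real"
    using continuous_imp_measurable_on_sets_lebesgue[OF continuous_on_subset[OF that] S'] by simp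
  have fb: "(\<lambda>x. f x \<bullet> b) \<in> weighted_L2 \<phi> S" if "b \<in> Basis" for b
    by (intro weighted_L2_component f that meas continuous_intros cont_\<phi>)
  define solves where "solves b v \<longleftrightarrow> v \<in> weighted_L2 \<phi> S \<and>
      (\<forall>\<psi>\<in>test_functions S. (LINT x|?M. laplacian \<psi> x * v x) = (LINT x|?M. \<psi> x * (f x \<bullet> b))) \<and>
      weighted_norm_sq \<phi> S v \<le> weighted_norm_sq \<phi> S (\<lambda>x. f x \<bullet> b) / (8 * ?n) \<and>
      ((\<forall>x\<in>S. f x \<bullet> b = 0) \<longrightarrow> v = (\<lambda>_. 0))" for b v
  have "\<forall>b\<in>Basis. \<exists>v. solves b v"
  proof
    fix b :: 'b assume b: "b \<in> Basis"
    show "\<exists>v. solves b v"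
    proof (cases "\<forall>x\<in>S. f x \<bullet> b = 0")
      case True
      have "(LINT x|?M. \<psi> x * (f x \<bullet> b)) = (LINT x|?M. 0)" for \<psi> :: "real^'n \<Rightarrow> real"
        using True by (intro Bochner_Integration.integral_cong) auto
      then have "solves b (\<lambda>_. 0)"
        by (simp add: solves_def weighted_L2_def weighted_norm_sq_def)
      then show ?thesis by (rule exI[of "solves b"])
    next
      case False
      obtain v where "v \<in> weighted_L2 \<phi> S"
        "\<And>\<psi>. \<psi> \<in> test_functions S \<Longrightarrow>
          (LINT x|?M. laplacian \<psi> x * v x) = (LINT x|?M. \<psi> x * (f x \<bullet> b))"
        "weighted_norm_sq \<phi> S v \<le> weighted_norm_sq \<phi> S (\<lambda>x. f x \<bullet> b) / (8 * ?n)"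
        by (rule scalar_Poisson_solvable[OF S fb[OF b, unfolded \<phi>_def], folded \<phi>_def]) blast
      with False have "solves b v" by (auto simp: solves_def)
      then show ?thesis by (rule exI[of "solves b"])
    qed
  qed
  from bchoice[OF this] obtain v where "\<forall>b\<in>Basis. solves b (v b)" ..
  then have v: "v b \<in> weighted_L2 \<phi> S"
    "\<psi> \<in> test_functions S \<Longrightarrow> (LINT x|?M. laplacian \<psi> x * v b x) = (LINT x|?M. \<psi> x * (f x \<bullet> b))"
    "weighted_norm_sq \<phi> S (v b) \<le> weighted_norm_sq \<phi> S (\<lambda>x. f x \<bullet> b) / (8 * ?n)"
    "\<forall>x\<in>S. f x \<bullet> b = 0 \<Longrightarrow> v b = (\<lambda>_. 0)" if "b \<in> Basis" for b \<psi>
    using that by (simp_all add: solves_def)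
  define u where "u x = (\<Sum>b\<in>Basis. v b x *\<^sub>R b)" for x
  have u_inner: "u x \<bullet> b = v b x" if "b \<in> Basis" for x b
    using that by (simp add: u_def)
  have ub: "(\<lambda>x. u x \<bullet> b) \<in> weighted_L2 \<phi> S" if "b \<in> Basis" for b
    using v(1)[OF that] by (simp add: u_inner[OF that])
  have "u \<in> borel_measurable ?M"
    unfolding u_def using v(1)
    by (intro borel_measurable_sum borel_measurable_scaleR borel_measurable_const) (simp add: weighted_L2_def)
  then have u: "u \<in> weighted_L2 \<phi> S"
    using weighted_norm_sq_components(1)[OF ub] by (simp add: weighted_L2_def)
  have pair: "integrable ?M (\<lambda>x. g x *\<^sub>R h x)"
    if "h \<in> weighted_L2 \<phi> S" "continuous_on UNIV g" "\<And>x. x \<notin> S \<Longrightarrow> g x = 0" "\<And>x. r < norm x \<Longrightarrow> g x = 0"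
    for g r and h :: "real^'n \<Rightarrow> 'b"
  proof (rule weighted_L2_integrable[OF that(1) meas[OF that(2)]])
    have "continuous_on UNIV (\<lambda>x. (g x)\<^sup>2 * exp (\<phi> x))"
      by (intro continuous_intros that(2) cont_\<phi>)
    then show "integrable ?M (\<lambda>x. (g x)\<^sup>2 * exp (\<phi> x))"
      by (rule lebesgue_on_eq_lborel(1)[OF S, where r = r]) (simp_all add: that(3,4))
  qed
  have weak: "(LINT x|?M. laplacian \<psi> x *\<^sub>R u x) = (LINT x|?M. \<psi> x *\<^sub>R f x)"
    if \<psi>: "\<psi> \<in> test_functions S" for \<psi>
  proof (rule euclidean_eqI)
    fix b :: 'b assume b: "b \<in> Basis"
    obtain r where r: "\<And>x. r < norm x \<Longrightarrow> \<psi> x = 0"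
      using test_function_zero_outside_ball[OF \<psi>] by blast
    have int_u: "integrable ?M (\<lambda>x. laplacian \<psi> x *\<^sub>R u x)"
      by (rule pair[OF u laplacian_continuous[OF \<psi>] laplacian_zero_outside[OF \<psi>]
            laplacian_zero_outside_ball[OF \<psi> r]])
    have int_f: "integrable ?M (\<lambda>x. \<psi> x *\<^sub>R f x)"
      by (rule pair[OF f test_function_continuous[OF \<psi>] test_function_zero_outside[OF \<psi>] r])
    have "(LINT x|?M. laplacian \<psi> x *\<^sub>R u x) \<bullet> b = (LINT x|?M. laplacian \<psi> x * v b x)"
      using int_u by (simp add: integral_inner_left[symmetric] u_inner[OF b])
    also have "\<dots> = (LINT x|?M. \<psi> x * (f x \<bullet> b))" by (rule v(2)[OF b \<psi>])
    also have "\<dots> = (LINT x|?M. \<psi> x *\<^sub>R f x) \<bullet> b"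
      using int_f by (simp add: integral_inner_left[symmetric])
    finally show "(LINT x|?M. laplacian \<psi> x *\<^sub>R u x) \<bullet> b = (LINT x|?M. \<psi> x *\<^sub>R f x) \<bullet> b" .
  qed
  show ?thesis
  proof
    show "u \<in> weighted_L2 \<phi> S" by (rule u)
    show "distributional_laplacian S u f"
      unfolding distributional_laplacian_def
      using weighted_L2_locally_integrable[OF u S cont_\<phi>] weighted_L2_locally_integrable[OF f S cont_\<phi>] weak
      by simp
    have "weighted_norm_sq \<phi> S u = (\<Sum>b\<in>Basis. weighted_norm_sq \<phi> S (\<lambda>x. u x \<bullet> b))"
      by (rule weighted_norm_sq_components(2)) (rule ub)
    also have "\<dots> \<le> (\<Sum>b\<in>Basis. weighted_norm_sq \<phi> S (\<lambda>x. f x \<bullet> b) / (8 * ?n))"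
      using v(3) by (intro sum_mono) (simp add: u_inner)
    also have "\<dots> = weighted_norm_sq \<phi> S f / (8 * ?n)"
      using weighted_norm_sq_components(2)[of f \<phi> S] fb by (simp add: sum_divide_distrib)
    finally show "weighted_norm_sq \<phi> S u \<le> weighted_norm_sq \<phi> S f / (8 * ?n)" .
    show "u x \<bullet> b = 0" if "b \<in> Basis" "\<forall>x\<in>S. f x \<bullet> b = 0" for b x
      using v(4)[OF that] that(1) by (simp add: u_inner)
  qed
qed

lemma inner_blade: "w \<bullet> blade A = coeff w A" for w :: "'n::finite clifford"
  by (simp add: inner_clifford_def if_distrib cong: if_cong)

lemma clifford_real_iff:
  "w \<in> \<real> \<longleftrightarrow> (\<forall>A. A \<noteq> {} \<longrightarrow> w \<bullet> blade A = 0)" for w :: "'n::{finite,linorder} clifford"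
proof
  assume "w \<in> \<real>"
  then obtain r where "w = of_real r" by (auto simp: Reals_def)
  then show "\<forall>A. A \<noteq> {} \<longrightarrow> w \<bullet> blade A = 0"
    by (simp add: inner_blade of_real_def one_clifford_def)
next
  assume *: "\<forall>A. A \<noteq> {} \<longrightarrow> w \<bullet> blade A = 0"
  then have "w = of_real (coeff w {})"
    by (auto simp: clifford_eq_iff inner_blade of_real_def one_clifford_def)
  then show "w \<in> \<real>" by (metis Reals_of_real)
qed

theorem corollary1p4:
  fixes \<Omega> :: "(real^'n::{finite,linorder}) set"
    and \<phi> :: "real^'n::{finite,linorder} \<Rightarrow> real"
    and f :: "real^'n::{finite,linorder} \<Rightarrow> 'n clifford"
  assumes "CARD('n) \<ge> 2"
    and "\<phi> = (\<lambda>x. (norm x)\<^sup>2)"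
    and "is_domain \<Omega>"
    and "\<Omega> \<subseteq> UNIV - {0}"
    and "f \<in> weighted_L2 \<phi> \<Omega>"
  shows "(\<exists>u. u \<in> weighted_L2 \<phi> \<Omega> \<and>
            distributional_laplacian \<Omega> u f \<and>
            weighted_norm_sq \<phi> \<Omega> u \<le> 1 / 16 * weighted_norm_sq \<phi> \<Omega> f) \<and>
         ((\<forall>x\<in>\<Omega>. f x \<in> \<real>) \<longrightarrow>
          (\<exists>u. u \<in> weighted_L2 \<phi> \<Omega> \<and>
            (\<forall>x\<in>\<Omega>. u x \<in> \<real>) \<and>
            distributional_laplacian \<Omega> u f \<and>
            weighted_norm_sq \<phi> \<Omega> u \<le> 1 / 16 * weighted_norm_sq \<phi> \<Omega> f))"
proof -
  have "open \<Omega>" using assms(3) by (simp add: is_domain_def)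
  then obtain u where u: "u \<in> weighted_L2 \<phi> \<Omega>" "distributional_laplacian \<Omega> u f"
    "weighted_norm_sq \<phi> \<Omega> u \<le> weighted_norm_sq \<phi> \<Omega> f / (8 * real CARD('n))"
    and zero: "\<And>b x. b \<in> Basis \<Longrightarrow> \<forall>x\<in>\<Omega>. f x \<bullet> b = 0 \<Longrightarrow> u x \<bullet> b = 0"
    using Poisson_solvable[OF _ assms(5)[unfolded assms(2)]] unfolding assms(2) by blast
  have "0 \<le> weighted_norm_sq \<phi> \<Omega> f" by (simp add: weighted_norm_sq_def)
  then have "weighted_norm_sq \<phi> \<Omega> f / (8 * real CARD('n)) \<le> weighted_norm_sq \<phi> \<Omega> f / 16"
    using assms(1) by (intro divide_left_mono) auto
  with u(3) have bound: "weighted_norm_sq \<phi> \<Omega> u \<le> 1 / 16 * weighted_norm_sq \<phi> \<Omega> f" by simp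
  have real: "\<forall>x\<in>\<Omega>. u x \<in> \<real>" if "\<forall>x\<in>\<Omega>. f x \<in> \<real>"
  proof
    fix x
    have "u x \<bullet> blade A = 0" if "A \<noteq> {}" for A
      using \<open>\<forall>x\<in>\<Omega>. f x \<in> \<real>\<close> that by (intro zero) (auto simp: Basis_clifford_def clifford_real_iff)
    then show "u x \<in> \<real>" by (simp add: clifford_real_iff)
  qed
  show ?thesis using u(1,2) bound real by blast
qed

end
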